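(* Let $G$ be a finite directed graph such that the undirected graph $\nabla G$ contains a cycle. Then the stable composite state problem ("given a CFSM protocol $\mathbf P$ with communication graph $G$ and a composite state $S$ of $\mathbf P$, is $S$ stable?") is algorithmically undecidable for CFSM protocols with communication graph $G$.
   Context: For a directed graph $G$, $\nabla G$ denotes the corresponding undirected (multi)graph obtained by forgetting edge orientations (parallel edges are kept, so e.g. two opposite edges between the same two nodes form a cycle). A CFSM protocol $\mathbf P$ with communication graph $G=(N,E)$ (each edge $\xi$ has tail $-\xi$ and head $+\xi$) consists of pairwise disjoint finite message sets $M_\xi$, $\xi\in E$, and for each $j\in N$ a finite state machine $F_j=(K_j,\Sigma_j,T_j,h_j)$ with finite state set $K_j$, initial state $h_j$, alphabet $\Sigma_j=\{+b: b\in M_\xi,\ j=+\xi\}\cup\{-b: b\in M_\xi,\ j=-\xi\}$ and transitions $T_j\subseteq K_j\times\Sigma_j\times K_j$ ($+b$ = receive, $-b$ = send). A composite state is $S=(p_j:j\in N)$, $p_j\in K_j$; a channel content is $C=(x_\xi:\xi\in E)$, $x_\xi\in M_\xi^*$; global states are pairs $(S,C)$; $C^0$ has all components empty and the initial global state is $((h_j:j\in N),C^0)$. A step: some machine $F_i$ takes a transition $p_i\xrightarrow{-b}q_i$ with $b\in M_\beta$, $i=-\beta$, and $b$ is appended to the end of $x_\beta$; or takes $p_i\xrightarrow{+b}q_i$ with $b\in M_\beta$, $i=+\beta$, where $x_\beta$ begins with $b$ and this first symbol is removed; all other machine states and channels are unchanged. A composite state $S$ is stable if the global state $(S,C^0)$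 is reachable from the initial global state by finitely many steps. *)

theory Defs
  imports Main "HOL-Library.Nat_Bijection"
begin

datatype recf =
    RZero
  | RSucc
  | RProj nat
  | RComp recf "recf list"
  | RPrim recf recf
  | RMin recf

inductive reval :: "recf \<Rightarrow> nat list \<Rightarrow> nat \<Rightarrow> bool" where
  reval_zero: "reval RZero xs 0"
| reval_succ: "reval RSucc (x # xs) (Suc x)"
| reval_proj: "i < length xs \<Longrightarrow> reval (RProj i) xs (xs ! i)"
| reval_comp: "list_all2 (\<lambda>g y. reval g xs y) gs ys \<Longrightarrow> reval f ys z
     \<Longrightarrow> reval (RComp f gs) xs z"
| reval_prim0: "reval f xs z \<Longrightarrow> reval (RPrim f g) (0 # xs) z"
| reval_primS: "reval (RPrim f g) (n # xs) y \<Longrightarrow> reval g (y # n # xs) z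
     \<Longrightarrow> reval (RPrim f g) (Suc n # xs) z"
| reval_min: "reval f (n # xs) 0 \<Longrightarrow> (\<forall>k<n. \<exists>y. y \<noteq> 0 \<and> reval f (k # xs) y)
     \<Longrightarrow> reval (RMin f) xs n"

definition decidable_on :: "('a \<Rightarrow> nat) \<Rightarrow> ('a \<Rightarrow> bool) \<Rightarrow> ('a \<Rightarrow> bool) \<Rightarrow> bool" where
  "decidable_on enc Adm Q \<longleftrightarrow>
     (\<exists>f. \<forall>x. Adm x \<longrightarrow> reval f [enc x] (if Q x then 1 else 0))"

text \<open>A finite directed multigraph with node set {0..<n} and edges 0..<length es;
  edge k has tail fst (es!k) and head snd (es!k).\<close>

definition graph_ok :: "nat \<Rightarrow> (nat \<times> nat) list \<Rightarrow> bool" where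
  "graph_ok n es \<longleftrightarrow> (\<forall>(a, b) \<in> set es. a < n \<and> b < n)"

text \<open>A cycle in the undirected multigraph obtained by forgetting orientations:
  a nonempty list of pairwise distinct edges cs, and vertices vs with
  vs!0 = vs!(length cs), the vertices vs!0..vs!(length cs - 1) pairwise distinct,
  and edge cs!k joining vs!k and vs!(k+1) (in either orientation).
  Self-loops (length 1) and pairs of parallel edges (length 2) are cycles.\<close>

definition undirected_cycle :: "(nat \<times> nat) list \<Rightarrow> nat list \<Rightarrow> nat list \<Rightarrow> bool" where
  "undirected_cycle es cs vs \<longleftrightarrow>
     cs \<noteq> [] \<and> distinct cs \<and> (\<forall>c \<in> set cs. c < length es) \<and>
     length vs = Suc (length cs) \<and> vs ! 0 = vs ! length cs \<and> distinct (butlast vs) \<and>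
     (\<forall>k < length cs. es ! (cs ! k) = (vs ! k, vs ! Suc k) \<or>
                      es ! (cs ! k) = (vs ! Suc k, vs ! k))"

definition has_undirected_cycle :: "(nat \<times> nat) list \<Rightarrow> bool" where
  "has_undirected_cycle es \<longleftrightarrow> (\<exists>cs vs. undirected_cycle es cs vs)"

text \<open>A transition (p, s, b, q): from state p to state q; s = True means the
  send action -b, s = False the receive action +b.\<close>
type_synonym trans = "nat \<times> bool \<times> nat \<times> nat"

text \<open>A finite state machine: (list of states K_j, initial state h_j, transitions T_j).\<close>
type_synonym fsm = "nat list \<times> nat \<times> trans list"

text \<open>A protocol: list of pairs (b, \<xi>) meaning message b belongs to M_\<xi>, and the
  list of machines F_0, ..., F_(n-1).\<close>
type_synonym protocol = "(nat \<times> nat) list \<times> fsm list"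

definition msg_of :: "protocol \<Rightarrow> nat \<Rightarrow> nat set" where
  "msg_of P \<xi> = {b. (b, \<xi>) \<in> set (fst P)}"

definition machine :: "protocol \<Rightarrow> nat \<Rightarrow> fsm" where
  "machine P j = snd P ! j"

definition states :: "protocol \<Rightarrow> nat \<Rightarrow> nat set" where
  "states P j = set (fst (machine P j))"

definition initial :: "protocol \<Rightarrow> nat \<Rightarrow> nat" where
  "initial P j = fst (snd (machine P j))"

definition transitions :: "protocol \<Rightarrow> nat \<Rightarrow> trans set" where
  "transitions P j = set (snd (snd (machine P j)))"

definition protocol_ok :: "nat \<Rightarrow> (nat \<times> nat) list \<Rightarrow> protocol \<Rightarrow> bool" where
  "protocol_ok n es P \<longleftrightarrow>
     (\<forall>(b, \<xi>) \<in> set (fst P). \<xi> < length es) \<and>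
     (\<forall>\<xi> \<xi>'. \<xi> \<noteq> \<xi>' \<longrightarrow> msg_of P \<xi> \<inter> msg_of P \<xi>' = {}) \<and>
     length (snd P) = n \<and>
     (\<forall>j < n. initial P j \<in> states P j \<and>
        (\<forall>(p, s, b, q) \<in> transitions P j. p \<in> states P j \<and> q \<in> states P j \<and>
           (\<exists>\<xi> < length es. b \<in> msg_of P \<xi> \<and>
              (if s then fst (es ! \<xi>) = j else snd (es ! \<xi>) = j))))"

definition composite_state :: "nat \<Rightarrow> protocol \<Rightarrow> nat list \<Rightarrow> bool" where
  "composite_state n P S \<longleftrightarrow> length S = n \<and> (\<forall>j < n. S ! j \<in> states P j)"

text \<open>Global states (S, C) with channel contents C = list of words, one per edge.\<close>
inductive step :: "nat \<Rightarrow> (nat \<times> nat) list \<Rightarrow> protocol \<Rightarrow>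
    nat list \<times> nat list list \<Rightarrow> nat list \<times> nat list list \<Rightarrow> bool"
  for n es P where
  step_send: "\<lbrakk> i < n; \<xi> < length es; b \<in> msg_of P \<xi>; fst (es ! \<xi>) = i;
      (S ! i, True, b, q) \<in> transitions P i \<rbrakk>
    \<Longrightarrow> step n es P (S, C) (S[i := q], C[\<xi> := C ! \<xi> @ [b]])"
| step_recv: "\<lbrakk> i < n; \<xi> < length es; b \<in> msg_of P \<xi>; snd (es ! \<xi>) = i;
      (S ! i, False, b, q) \<in> transitions P i; C ! \<xi> = b # w \<rbrakk>
    \<Longrightarrow> step n es P (S, C) (S[i := q], C[\<xi> := w])"

definition initial_global :: "nat \<Rightarrow> (nat \<times> nat) list \<Rightarrow> protocol \<Rightarrow> nat list \<times> nat list list" where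
  "initial_global n es P = (map (initial P) [0..<n], replicate (length es) [])"

definition stable_cs :: "nat \<Rightarrow> (nat \<times> nat) list \<Rightarrow> protocol \<Rightarrow> nat list \<Rightarrow> bool" where
  "stable_cs n es P S \<longleftrightarrow>
     (step n es P)\<^sup>*\<^sup>* (initial_global n es P) (S, replicate (length es) [])"

definition enc_trans :: "trans \<Rightarrow> nat" where
  "enc_trans t = (case t of (p, s, b, q) \<Rightarrow> list_encode [p, if s then 1 else 0, b, q])"

definition enc_fsm :: "fsm \<Rightarrow> nat" where
  "enc_fsm F = (case F of (Ks, h, Ts) \<Rightarrow>
      list_encode [list_encode Ks, h, list_encode (map enc_trans Ts)])"

definition enc_protocol :: "protocol \<Rightarrow> nat" where
  "enc_protocol P = list_encode [list_encode (map prod_encode (fst P)),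
                                 list_encode (map enc_fsm (snd P))]"

definition enc_instance :: "protocol \<times> nat list \<Rightarrow> nat" where
  "enc_instance x = prod_encode (enc_protocol (fst x), list_encode (snd x))"

definition instance_ok :: "nat \<Rightarrow> (nat \<times> nat) list \<Rightarrow> protocol \<times> nat list \<Rightarrow> bool" where
  "instance_ok n es x \<longleftrightarrow> protocol_ok n es (fst x) \<and> composite_state n (fst x) (snd x)"

end

theory Submission
  imports Defs
begin

text \<open>
  Suppose that a recursive function \<open>f\<close> decides stability, and let \<open>D\<close> be the partial recursive
  function that halts on \<open>e\<close> iff \<open>f\<close> rejects the instance with code \<open>instance_code e\<close>. That instance
  simulates, on input \<open>e\<close>, the automaton whose transition list has code \<open>e\<close>. Taking for \<open>e\<close> the code of
  an automaton that simulates \<open>D\<close>, the instance is stable iff \<open>D\<close> halts on \<open>e\<close> iff it is not stable.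

  Partial recursive functions are computed by nondeterministic counter programs, that is, by relations
  generated from increments, decrements and zero tests by composition and iteration. A counter program
  is implemented by a regular language of write and consume operations on a queue that holds the
  register contents in unary: every instruction rotates the queue once.

  On the cycle, one node runs an automaton for this language; it writes on its first cycle edge and
  consumes on its second one, whatever their orientations (so that to write may mean to receive). All
  other nodes of the cycle copy letters between their two edges, which forces the words that pass
  over all edges to be equal. If the cycle is directed, this is a queue. Otherwise the order of
  writing and consuming is not controlled, but equality of the word written and the word consumed
  already implies that the computation halts, since both words are parsed uniquely into blocks.
\<close>

section \<open>Computable functions\<close>

text \<open>The diagonal runs over automata because \<open>D\<close> enters its own construction: it
  calls \<open>instance_code\<close>, so an instance built around an automaton for \<open>D\<close>
  would presuppose itself. Letting the input \<open>e\<close> carry the transition list breaks the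
  circle: \<open>instance_code\<close> is fixed before \<open>D\<close> exists, and splicing the
  list coded by \<open>e\<close> into a machine is a computable operation on codes.

  Nondeterminism is what lets regular languages serve as a programming language. Sequencing and
  looping become concatenation and star, and a wrong choice, such as a loop left too early, merely
  has no accepting continuation.

  The full rotation per instruction answers the fact that a queue shows only its front: afterwards
  register 0 is in front again, so instructions compose without remembering a position. It also
  makes every instruction consume as many blocks as it writes. Hence the register contents between
  any two instructions can be recovered from the two projected words by counting blocks, whatever
  the order in which the actions took place.\<close>

lemma reval_deterministic: "reval f xs y \<Longrightarrow> reval f xs z \<Longrightarrow> z = y"
proof (induction arbitrary: z rule: reval.induct)
  case (reval_zero xs)
  then show ?case by (auto elim: reval.cases)
next
  case (reval_succ x xs)
  then show ?case by (auto elim: reval.cases)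
next
  case (reval_proj i xs)
  from reval_proj(2) show ?case by (auto elim: reval.cases)
next
  case (reval_comp xs gs ys f y)
  from reval_comp.prems obtain zs
    where zs: "list_all2 (\<lambda>g y. reval g xs y) gs zs" "reval f zs z"
    by (auto elim: reval.cases)
  have "zs = ys"
    using zs(1) reval_comp.IH(1)
    by (auto simp: list_all2_conv_all_nth intro!: nth_equalityI)
  then show ?case using zs(2) reval_comp.IH(2) by blast
next
  case (reval_prim0 f xs y g)
  from reval_prim0.prems have "reval f xs z" by (auto elim: reval.cases)
  then show ?case using reval_prim0.IH by blast
next
  case (reval_primS f g n xs y w)
  from reval_primS.prems obtain y' where "reval (RPrim f g) (n # xs) y'" "reval g (y' # n # xs) z"
    by (auto elim: reval.cases)
  then show ?case using reval_primS.IH by blast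
next
  case (reval_min f n xs)
  from reval_min.prems have z: "reval f (z # xs) 0"
    "\<forall>k<z. \<exists>y. y \<noteq> 0 \<and> reval f (k # xs) y"
    by (auto elim: reval.cases)
  have "\<not> z < n" using z(1) reval_min.IH(2) by blast
  moreover have "\<not> n < z"
    using z(2) reval_min.IH(1) by blast
  ultimately show ?case by simp
qed

definition computable :: "nat \<Rightarrow> (nat list \<Rightarrow> nat) \<Rightarrow> bool" where
  "computable k F \<longleftrightarrow> (\<exists>f. \<forall>xs. length xs = k \<longrightarrow> reval f xs (F xs))"

lemma computable_cong:
  "computable k F \<Longrightarrow> (\<And>xs. length xs = k \<Longrightarrow> F xs = G xs) \<Longrightarrow> computable k G"
  unfolding computable_def by metis

lemma computable_if:
  "computable k F \<Longrightarrow> computable k G \<Longrightarrow> computable k (\<lambda>xs. if b then F xs else G xs)"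
  by (cases b) simp_all

lemma computable_proj: "i < k \<Longrightarrow> computable k (\<lambda>xs. xs ! i)"
  unfolding computable_def by (intro exI[of _ "RProj i"]) (auto intro: reval_proj)

lemma computable_comp1:
  assumes "computable 1 (\<lambda>xs. G (xs ! 0))" "computable k F"
  shows "computable k (\<lambda>xs. G (F xs))"
proof -
  obtain g where g: "\<And>xs. length xs = 1 \<Longrightarrow> reval g xs (G (xs ! 0))"
    using assms(1) unfolding computable_def by auto
  obtain f where f: "\<And>xs. length xs = k \<Longrightarrow> reval f xs (F xs)"
    using assms(2) unfolding computable_def by auto
  have "reval (RComp g [f]) xs (G (F xs))" if "length xs = k" for xs
    using f[OF that] g[of "[F xs]"] by (auto intro: reval_comp[where ys="[F xs]"])
  then show ?thesis unfolding computable_def by blast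
qed

lemma computable_comp2:
  assumes "computable 2 (\<lambda>xs. G (xs ! 0) (xs ! 1))" "computable k F" "computable k H"
  shows "computable k (\<lambda>xs. G (F xs) (H xs))"
proof -
  obtain g where g: "\<And>xs. length xs = 2 \<Longrightarrow> reval g xs (G (xs ! 0) (xs ! 1))"
    using assms(1) unfolding computable_def by auto
  obtain f where f: "\<And>xs. length xs = k \<Longrightarrow> reval f xs (F xs)"
    using assms(2) unfolding computable_def by auto
  obtain h where h: "\<And>xs. length xs = k \<Longrightarrow> reval h xs (H xs)"
    using assms(3) unfolding computable_def by auto
  have "reval (RComp g [f, h]) xs (G (F xs) (H xs))" if "length xs = k" for xs
    using f[OF that] h[OF that] g[of "[F xs, H xs]"]
    by (auto intro: reval_comp[where ys="[F xs, H xs]"])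
  then show ?thesis unfolding computable_def by blast
qed

lemma computable_Suc:
  assumes "computable k F"
  shows "computable k (\<lambda>xs. Suc (F xs))"
proof (rule computable_comp1[OF _ assms])
  show "computable 1 (\<lambda>xs. Suc (xs ! 0))"
    unfolding computable_def
    by (intro exI[of _ RSucc]) (auto simp: length_Suc_conv intro: reval_succ)
qed

lemma computable_const: "computable k (\<lambda>_. c)"
proof (induction c)
  case 0
  show ?case unfolding computable_def by (intro exI[of _ RZero]) (auto intro: reval_zero)
next
  case (Suc c)
  then show ?case by (rule computable_Suc)
qed

lemma computable_primrec:
  assumes B: "computable k B" and G: "computable (Suc (Suc k)) G"
    and F0: "\<And>xs. length xs = k \<Longrightarrow> F 0 xs = B xs"
    and FS: "\<And>n xs. length xs = k \<Longrightarrow> F (Suc n) xs = G (F n xs # n # xs)"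
  shows "computable (Suc k) (\<lambda>xs. F (hd xs) (tl xs))"
proof -
  obtain b where b: "\<And>xs. length xs = k \<Longrightarrow> reval b xs (B xs)"
    using B unfolding computable_def by auto
  obtain g where g: "\<And>xs. length xs = Suc (Suc k) \<Longrightarrow> reval g xs (G xs)"
    using G unfolding computable_def by auto
  have "reval (RPrim b g) (n # xs) (F n xs)" if "length xs = k" for n xs
  proof (induction n)
    case 0
    show ?case using b[OF that] F0[OF that] by (auto intro: reval_prim0)
  next
    case (Suc n)
    have "reval g (F n xs # n # xs) (F (Suc n) xs)"
      using g[of "F n xs # n # xs"] that by (simp add: FS)
    with Suc show ?case by (rule reval_primS)
  qed
  then show ?thesis
    unfolding computable_def by (intro exI[of _ "RPrim b g"]) (auto simp: length_Suc_conv)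
qed

lemma computable_add:
  assumes "computable k F" "computable k H"
  shows "computable k (\<lambda>xs. F xs + H xs)"
proof (rule computable_comp2[OF _ assms])
  have "computable (Suc 1) (\<lambda>xs. (\<lambda>n xs. n + xs ! 0) (hd xs) (tl xs))"
    by (rule computable_primrec[where B="\<lambda>xs. xs ! 0" and G="\<lambda>xs. Suc (xs ! 0)"])
      (auto intro: computable_proj computable_Suc)
  then show "computable 2 (\<lambda>xs. xs ! 0 + xs ! 1)"
    unfolding One_nat_def numeral_2_eq_2
    by (rule computable_cong) (auto simp: length_Suc_conv)
qed

lemma computable_iterate:
  assumes "computable k H" "computable k B"
    and G: "computable 2 (\<lambda>xs. G (xs ! 0) (xs ! 1))"
    and F: "\<And>b. F 0 b = b" "\<And>n b. F (Suc n) b = G (F n b) n"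
  shows "computable k (\<lambda>xs. F (H xs) (B xs))"
proof (rule computable_comp2[OF _ assms(1,2)])
  have "computable (Suc 1) (\<lambda>xs. (\<lambda>n xs. F n (xs ! 0)) (hd xs) (tl xs))"
    by (rule computable_primrec[where B="\<lambda>xs. xs ! 0" and G="\<lambda>xs. G (xs ! 0) (xs ! 1)"])
      (auto intro: computable_proj computable_comp2[OF G] simp: F)
  then show "computable 2 (\<lambda>xs. F (xs ! 0) (xs ! 1))"
    unfolding One_nat_def numeral_2_eq_2
    by (rule computable_cong) (auto simp: length_Suc_conv)
qed

lemma computable_prod_encode:
  assumes "computable k F" "computable k H"
  shows "computable k (\<lambda>xs. prod_encode (F xs, H xs))"
proof -
  have "computable k (\<lambda>xs. (\<lambda>n b. triangle n + b) (F xs + H xs) 0)"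
    by (rule computable_iterate[where G="\<lambda>y n. y + Suc n"])
      (auto intro!: computable_add computable_Suc computable_proj computable_const assms)
  then show ?thesis
    unfolding prod_encode_def using computable_add[OF _ assms(1)] by simp
qed

lemma computable_list_encode:
  assumes "\<And>j. j \<in> set js \<Longrightarrow> computable k (G j)"
  shows "computable k (\<lambda>xs. list_encode (map (\<lambda>j. G j xs) js))"
  using assms
  by (induction js) (auto intro!: computable_const computable_Suc computable_prod_encode)

text \<open>A recursion on the counter puts each new element at the front of the coded list, as the
  \<open>Suc\<close> of a pair code, so the elements come out in reverse. For this reason
  \<open>main_machine\<close> lists its states and its chain backwards.\<close>

lemma computable_list_encode_rev_iterate:
  assumes "computable k H" "computable k B" "computable 1 (\<lambda>xs. G (xs ! 0))"
    and "\<And>xs. B xs = list_encode (L xs)"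
  shows "computable k (\<lambda>xs. list_encode (rev (map G [0..<H xs]) @ L xs))"
proof -
  define F where "F = (\<lambda>n b. rec_nat b (\<lambda>m y. Suc (prod_encode (G m, y))) n)"
  have "computable k (\<lambda>xs. F (H xs) (B xs))"
    using assms(1,2)
  proof (rule computable_iterate)
    show "computable 2 (\<lambda>xs. Suc (prod_encode (G (xs ! 1), xs ! 0)))"
      by (intro computable_Suc computable_prod_encode computable_comp1[OF assms(3)] computable_proj)
        auto
  qed (auto simp: F_def)
  moreover have "F n (list_encode l) = list_encode (rev (map G [0..<n]) @ l)" for n l
    by (induction n) (auto simp: F_def)
  ultimately show ?thesis using assms(4) by simp
qed

section \<open>Regular languages\<close>

definition deriv :: "'a list \<Rightarrow> 'a list set \<Rightarrow> 'a list set" where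
  "deriv u L = {v. u @ v \<in> L}"

text \<open>The Myhill-Nerode criterion. Closure under concatenation and star becomes a count of
  left quotients; an automaton is built only once, with the quotients as states.\<close>

definition regular :: "'a list set \<Rightarrow> bool" where
  "regular L \<longleftrightarrow> finite (range (\<lambda>u. deriv u L))"

definition conc :: "'a list set \<Rightarrow> 'a list set \<Rightarrow> 'a list set" (infixr "\<cdot>" 75) where
  "A \<cdot> B = {u @ v |u v. u \<in> A \<and> v \<in> B}"

inductive_set star :: "'a list set \<Rightarrow> 'a list set" for A where
  star_Nil: "[] \<in> star A"
| star_app: "u \<in> A \<Longrightarrow> v \<in> star A \<Longrightarrow> u @ v \<in> star A"

lemma concI: "u \<in> A \<Longrightarrow> v \<in> B \<Longrightarrow> u @ v \<in> A \<cdot> B"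
  by (auto simp: conc_def)

lemma concE:
  assumes "w \<in> A \<cdot> B" obtains u v where "w = u @ v" "u \<in> A" "v \<in> B"
  using assms by (auto simp: conc_def)

lemma regularI:
  assumes "finite D" "\<And>u. deriv u L \<in> D"
  shows "regular L"
  unfolding regular_def using assms by (meson finite_subset image_subset_iff)

lemma regular_empty: "regular {}"
  by (rule regularI[of "{{}}"]) (auto simp: deriv_def)

lemma regular_Nil: "regular {[]}"
  by (rule regularI[of "{{}, {[]}}"]) (auto simp: deriv_def)

lemma regular_single: "regular {[a]}"
proof (rule regularI[of "{{}, {[]}, {[a]}}"])
  fix u show "deriv u {[a]} \<in> {{}, {[]}, {[a]}}"
    by (cases u) (auto simp: deriv_def)
qed simp

lemma deriv_conc:
  "deriv w (A \<cdot> B) = deriv w A \<cdot> B \<union> \<Union> {deriv v B |v. \<exists>u. w = u @ v \<and> u \<in> A}"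
proof (intro equalityI subsetI)
  fix x assume "x \<in> deriv w (A \<cdot> B)"
  then obtain u v where uv: "w @ x = u @ v" "u \<in> A" "v \<in> B"
    by (auto simp: deriv_def elim: concE)
  from uv(1) consider z where "u = w @ z" "x = z @ v" | z where "w = u @ z" "v = z @ x"
    by (auto simp: append_eq_append_conv2)
  then show "x \<in> deriv w A \<cdot> B \<union> \<Union> {deriv v B |v. \<exists>u. w = u @ v \<and> u \<in> A}"
    using uv(2,3) by cases (auto simp: deriv_def intro!: concI)
next
  fix x assume "x \<in> deriv w A \<cdot> B \<union> \<Union> {deriv v B |v. \<exists>u. w = u @ v \<and> u \<in> A}"
  then show "x \<in> deriv w (A \<cdot> B)"
    by (auto simp: deriv_def conc_def) (metis append.assoc)+
qed

text \<open>By \<open>deriv_conc\<close> a quotient of the product is determined by one quotient of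
  \<open>A\<close> and a set of quotients of \<open>B\<close>, and there are finitely many such
  pairs.\<close>

lemma regular_conc:
  assumes "regular A" "regular B"
  shows "regular (A \<cdot> B)"
proof (rule regularI)
  let ?D = "(\<lambda>(X, Y). X \<cdot> B \<union> \<Union> Y) ` (range (\<lambda>u. deriv u A) \<times> Pow (range (\<lambda>u. deriv u B)))"
  show "finite ?D" using assms by (auto simp: regular_def)
  show "deriv w (A \<cdot> B) \<in> ?D" for w
    by (rule image_eqI[where x="(deriv w A, {deriv v B |v. \<exists>u. w = u @ v \<and> u \<in> A})"])
      (auto simp: deriv_conc)
qed

lemma star_append: "u \<in> star A \<Longrightarrow> v \<in> star A \<Longrightarrow> u @ v \<in> star A"
  by (induction rule: star.induct) (auto intro: star_app)

text \<open>The cut between \<open>w\<close> and \<open>x\<close> falls into the factor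
  \<open>v @ x1\<close>, possibly at its end with \<open>x1 = []\<close>. A factor that contains the
  last letter of \<open>w\<close> exists because \<open>w\<close> is nonempty.\<close>

lemma star_split:
  assumes "z \<in> star A" "z = w @ x" "w \<noteq> []"
  shows "\<exists>u v x1 x2. w = u @ v \<and> u \<in> star A \<and> v @ x1 \<in> A \<and> x2 \<in> star A \<and> x = x1 @ x2"
  using assms
proof (induction arbitrary: w rule: star.induct)
  case star_Nil
  then show ?case by simp
next
  case (star_app p q)
  from star_app.prems consider z where "p = w @ z" "x = z @ q" | z where "w = p @ z" "q = z @ x"
    by (auto simp: append_eq_append_conv2)
  then show ?case
  proof cases
    case 1
    then show ?thesis using star_app.hyps
      by (intro exI[of _ "[]"] exI[of _ w] exI[of _ z] exI[of _ q]) (auto intro: star_Nil)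
  next
    case 2
    show ?thesis
    proof (cases "z = []")
      case True
      then show ?thesis using 2 star_app.hyps star_app.prems
        by (intro exI[of _ "[]"] exI[of _ p] exI[of _ "[]"] exI[of _ x]) (auto intro: star_Nil)
    next
      case False
      from star_app.IH[OF 2(2) False] obtain u v x1 x2 where
        *: "z = u @ v" "u \<in> star A" "v @ x1 \<in> A" "x2 \<in> star A" "x = x1 @ x2" by blast
      show ?thesis
        by (rule exI[of _ "p @ u"], rule exI[of _ v], rule exI[of _ x1], rule exI[of _ x2])
          (use * 2 star_app.hyps in \<open>auto intro: star.star_app\<close>)
    qed
  qed
qed

lemma deriv_star:
  assumes "w \<noteq> []"
  shows "deriv w (star A) = \<Union> {deriv v A |v. \<exists>u. w = u @ v \<and> u \<in> star A} \<cdot> star A"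
proof (intro equalityI subsetI)
  fix x assume "x \<in> deriv w (star A)"
  then have "w @ x \<in> star A" by (simp add: deriv_def)
  from star_split[OF this refl assms] obtain u v x1 x2 where
    *: "w = u @ v" "u \<in> star A" "v @ x1 \<in> A" "x2 \<in> star A" "x = x1 @ x2" by blast
  show "x \<in> \<Union> {deriv v A |v. \<exists>u. w = u @ v \<and> u \<in> star A} \<cdot> star A"
    unfolding *(5) by (rule concI[OF _ *(4)]) (use * in \<open>auto simp: deriv_def\<close>)
next
  fix x assume "x \<in> \<Union> {deriv v A |v. \<exists>u. w = u @ v \<and> u \<in> star A} \<cdot> star A"
  then obtain u v x1 x2 where
    *: "w = u @ v" "u \<in> star A" "v @ x1 \<in> A" "x2 \<in> star A" "x = x1 @ x2"
    by (auto simp: deriv_def elim!: concE)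
  have "u @ ((v @ x1) @ x2) \<in> star A"
    using * by (intro star_append star_app)
  then show "x \<in> deriv w (star A)" using * by (simp add: deriv_def)
qed

lemma regular_star:
  assumes "regular A"
  shows "regular (star A)"
proof (rule regularI)
  \<comment> \<open>The quotient by the empty word is \<open>star A\<close> itself, outside the
    pattern of \<open>deriv_star\<close>.\<close>
  let ?D = "insert (star A) ((\<lambda>Y. \<Union> Y \<cdot> star A) ` Pow (range (\<lambda>u. deriv u A)))"
  show "finite ?D" using assms by (auto simp: regular_def)
  show "deriv w (star A) \<in> ?D" for w
  proof (cases "w = []")
    case True
    then show ?thesis by (simp add: deriv_def)
  next
    case False
    then show ?thesis
      by (intro insertI2 image_eqI[where x="{deriv v A |v. \<exists>u. w = u @ v \<and> u \<in> star A}"])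
        (auto simp: deriv_star)
  qed
qed

section \<open>Automata whose states are left quotients\<close>

inductive path :: "('s \<times> 'a \<times> 's) set \<Rightarrow> 's \<Rightarrow> 'a list \<Rightarrow> 's \<Rightarrow> bool" for T where
  path_Nil: "path T p [] p"
| path_Cons: "(p, a, q) \<in> T \<Longrightarrow> path T q w r \<Longrightarrow> path T p (a # w) r"

lemma path_append: "path T p u q \<Longrightarrow> path T q v r \<Longrightarrow> path T p (u @ v) r"
  by (induction rule: path.induct) (auto intro: path_Cons)

lemma path_snoc: "path T p u q \<Longrightarrow> (q, a, r) \<in> T \<Longrightarrow> path T p (u @ [a]) r"
  by (rule path_append) (auto intro: path.intros)

text \<open>The parity condition reserves the odd state numbers from 3 on for the chain of states that
  writes the input.\<close>

lemma regular_automaton: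
  fixes L :: "'a::finite list set"
  assumes reg: "regular L" and ne: "[] \<notin> L"
  obtains T :: "(nat \<times> 'a \<times> nat) set" where "finite T"
    "\<And>w. path T 1 w 0 \<longleftrightarrow> w \<in> L"
    "\<And>p a q. (p, a, q) \<in> T \<Longrightarrow> (p = 1 \<or> (even p \<and> p \<noteq> 0)) \<and> (q = 1 \<or> even q)"
proof -
  define D where "D = range (\<lambda>u. deriv u L)"
  have fin: "finite D" using reg by (simp add: regular_def D_def)
  obtain f :: "'a list set \<Rightarrow> nat" where f: "inj_on f D"
    using finite_imp_inj_to_nat_seg[OF fin] by blast
  \<comment> \<open>The language \<open>L\<close> itself becomes the initial state 1, and the other
    quotients get even numbers from 2 on. This leaves 0 for a final state.\<close>
  define c where "c X = (if X = L then 1 else 2 * f X + 2)" for X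
  have c_parity: "c X \<noteq> 0" "c X = 1 \<or> even (c X)" for X by (auto simp: c_def)
  have c_inj: "c X = c Y \<Longrightarrow> X = Y" if "X \<in> D" "Y \<in> D" for X Y
    using f that by (auto simp: c_def inj_on_def split: if_splits)
  have closed: "deriv [a] X \<in> D" if "X \<in> D" for a X
  proof -
    from that obtain u where "X = deriv u L" by (auto simp: D_def)
    then have "deriv [a] X = deriv (u @ [a]) L" by (simp add: deriv_def)
    then show ?thesis by (simp add: D_def)
  qed
  have L_in: "L \<in> D"
    unfolding D_def by (rule image_eqI[where x="[]"]) (auto simp: deriv_def)
  \<comment> \<open>The final state 0 is not a quotient: a transition may jump there on a letter
    that completes a word, and nothing leaves it. Acceptance is thus one fixed local state, which a
    composite state can name. The empty word cannot be accepted in this way, hence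
    \<open>ne\<close>.\<close>
  define T where
    "T = {(c X, a, q) |X a q. X \<in> D \<and> (q = c (deriv [a] X) \<or> q = 0 \<and> [a] \<in> X)}"
  have "T \<subseteq> c ` D \<times> UNIV \<times> insert 0 (c ` D)"
    using closed by (auto simp: T_def)
  moreover have "finite (c ` D \<times> (UNIV :: 'a set) \<times> insert 0 (c ` D))"
    using fin by simp
  ultimately have finT: "finite T" by (rule finite_subset)
  have T_iff: "(c X, a, q) \<in> T \<longleftrightarrow> q = c (deriv [a] X) \<or> q = 0 \<and> [a] \<in> X"
    if "X \<in> D" for X a q
    using c_inj[OF that] that by (auto simp: T_def)
  have zero: "(0, a, q) \<notin> T" for a q
    using c_parity(1) by (auto simp: T_def)
  have runs: "path T (c X) w 0 \<longleftrightarrow> w \<in> X \<and> w \<noteq> []" if "X \<in> D" for X w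
    using that
  proof (induction w arbitrary: X)
    case Nil
    then show ?case using c_parity(1)[of X] by (auto elim: path.cases)
  next
    case (Cons a w)
    have "path T (c X) (a # w) 0 \<longleftrightarrow> (\<exists>q. (c X, a, q) \<in> T \<and> path T q w 0)"
      by (auto elim: path.cases intro: path_Cons)
    also have "\<dots> \<longleftrightarrow> path T (c (deriv [a] X)) w 0 \<or> ([a] \<in> X \<and> path T 0 w 0)"
      using T_iff[OF Cons.prems] by auto
    also have "path T 0 w 0 \<longleftrightarrow> w = []"
      using zero by (auto elim: path.cases intro: path_Nil)
    also have "path T (c (deriv [a] X)) w 0 \<longleftrightarrow> a # w \<in> X \<and> w \<noteq> []"
      using Cons.IH[OF closed[OF Cons.prems]] by (simp add: deriv_def)
    finally show ?case by auto
  qed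
  have "path T 1 w 0 \<longleftrightarrow> w \<in> L" for w
    using runs[OF L_in, of w] ne by (auto simp: c_def)
  moreover have "(p = 1 \<or> (even p \<and> p \<noteq> 0)) \<and> (q = 1 \<or> even q)" if "(p, a, q) \<in> T" for p a q
    using that c_parity by (auto simp: T_def)
  ultimately show ?thesis using that[OF finT] by blast
qed

section \<open>Queue implementations of relations on registers\<close>

definition written :: "(bool \<times> 'b) list \<Rightarrow> 'b list" where
  "written w = map snd (filter fst w)"

definition consumed :: "(bool \<times> 'b) list \<Rightarrow> 'b list" where
  "consumed w = map snd (filter (Not \<circ> fst) w)"

lemma written_simps [simp]:
  "written [] = []" "written ((True, b) # w) = b # written w" "written ((False, b) # w) = written w"
  "written (u @ v) = written u @ written v"
  by (auto simp: written_def)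

lemma consumed_simps [simp]:
  "consumed [] = []" "consumed ((True, b) # w) = consumed w"
  "consumed ((False, b) # w) = b # consumed w"
  "consumed (u @ v) = consumed u @ consumed v"
  by (auto simp: consumed_def)

inductive qrun :: "'b list \<Rightarrow> (bool \<times> 'b) list \<Rightarrow> 'b list \<Rightarrow> bool" where
  qrun_Nil: "qrun q [] q"
| qrun_write: "qrun (q @ [b]) w q' \<Longrightarrow> qrun q ((True, b) # w) q'"
| qrun_consume: "qrun q w q' \<Longrightarrow> qrun (b # q) ((False, b) # w) q'"

lemma qrun_append: "qrun q u q' \<Longrightarrow> qrun q' v q'' \<Longrightarrow> qrun q (u @ v) q''"
  by (induction rule: qrun.induct) (auto intro: qrun.intros)

text \<open>With both queues empty, this equation is all that remains of a run when the cycle does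
  not enforce the order of the queue.\<close>

lemma qrun_written_consumed: "qrun q w q' \<Longrightarrow> q @ written w = consumed w @ q'"
  by (induction rule: qrun.induct) auto

lemma qrun_write_all: "qrun q (map (Pair True) u) (q @ u)"
  by (induction u arbitrary: q) (auto intro!: qrun.intros, metis append.assoc append_Cons append_Nil)

lemma qrun_consume_all: "qrun u (map (Pair False) u) []"
  by (induction u) (auto intro: qrun.intros)

text \<open>A queue holds a list of numbers in unary, each followed by the separator \<open>True\<close>.\<close>

definition block :: "nat \<Rightarrow> bool list" where
  "block x = replicate x False @ [True]"

definition blocks :: "nat list \<Rightarrow> bool list" where
  "blocks xs = concat (map block xs)"

lemma blocks_simps [simp]:
  "blocks [] = []" "blocks (x # xs) = block x @ blocks xs" "blocks (xs @ ys) = blocks xs @ blocks ys"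
  by (auto simp: blocks_def)

text \<open>The blocks form a prefix code: \<open>True\<close> occurs in a block only as its last
  letter.\<close>

lemma block_append_eq: "block x @ u = block y @ v \<longleftrightarrow> x = y \<and> u = v"
proof (induction x arbitrary: y)
  case 0
  then show ?case by (cases y) (auto simp: block_def)
next
  case (Suc x)
  then show ?case by (cases y) (auto simp: block_def)
qed

text \<open>The prefix code property alone forces the remainder \<open>d\<close> to be a list of
  blocks as well.\<close>

lemma blocks_eq_append:
  "blocks xs = blocks us @ d \<Longrightarrow> \<exists>ys. xs = us @ ys \<and> d = blocks ys"
proof (induction us arbitrary: xs)
  case (Cons u us)
  show ?case
  proof (cases xs)
    case Nil
    then show ?thesis using Cons.prems by (simp add: block_def)
  next
    case (Cons x xs')
    then show ?thesis using Cons.prems Cons.IH[of xs'] by (auto simp: block_append_eq)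
  qed
qed simp

text \<open>Completeness asks for every rest \<open>q\<close> of the queue, because other blocks
  stand behind the one being processed. Soundness speaks of the two projections only, which is all
  that the cycle guarantees.\<close>

definition block_impl :: "(nat \<times> nat) set \<Rightarrow> (bool \<times> bool) list set \<Rightarrow> bool" where
  "block_impl \<beta> A \<longleftrightarrow> regular A \<and>
     (\<forall>(x, y) \<in> \<beta>. \<exists>w \<in> A. \<forall>q. qrun (block x @ q) w (q @ block y)) \<and>
     (\<forall>w \<in> A. \<exists>(x, y) \<in> \<beta>. consumed w = block x \<and> written w = block y)"

lemma regular_singleton: "regular {u}"
proof (induction u)
  case Nil
  show ?case by (rule regular_Nil)
next
  case (Cons a u)
  have "{a # u} = {[a]} \<cdot> {u}" by (auto simp: conc_def)
  then show ?case using Cons by (simp add: regular_conc regular_single)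
qed

definition copy_lang :: "(bool \<times> bool) list set" where
  "copy_lang = star {[(False, False), (True, False)]} \<cdot> {[(False, True), (True, True)]}"

lemma regular_copy_lang: "regular copy_lang"
  by (simp add: copy_lang_def regular_conc regular_star regular_singleton)

lemma copy_lang_complete: "\<exists>w \<in> copy_lang. \<forall>q. qrun (block x @ q) w (q @ block x)"
proof -
  define u where "u = concat (replicate x [(False, False), (True, False)])"
  have "u \<in> star {[(False, False), (True, False)]}"
    unfolding u_def by (induction x) (auto intro: star_Nil star_app[of "[_, _]", simplified])
  then have "u @ [(False, True), (True, True)] \<in> copy_lang"
    by (auto simp: copy_lang_def conc_def)
  moreover have "qrun (block x @ q) (u @ [(False, True), (True, True)]) (q @ block x)" for q
    unfolding u_def
  proof (induction x arbitrary: q)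
    case 0
    show ?case by (auto simp: block_def intro!: qrun.intros)
  next
    case (Suc x)
    then show ?case
      using Suc[of "q @ [False]"] by (auto simp: block_def intro!: qrun.intros)
  qed
  ultimately show ?thesis by blast
qed

lemma copy_lang_sound: "w \<in> copy_lang \<Longrightarrow> \<exists>x. consumed w = block x \<and> written w = block x"
proof -
  have "\<exists>x. consumed u = replicate x False \<and> written u = replicate x False"
    if "u \<in> star {[(False, False), (True, False)]}" for u
    using that by (induction rule: star.induct) (auto, metis replicate_Suc)
  then show "w \<in> copy_lang \<Longrightarrow> ?thesis"
    unfolding copy_lang_def by (fastforce simp: block_def elim!: concE)
qed

lemma block_impl_copy: "block_impl Id copy_lang"
  using regular_copy_lang copy_lang_complete copy_lang_sound
  unfolding block_impl_def by fastforce

lemma block_impl_inc: "block_impl {(x, Suc x) |x. True} ({[(True, False)]} \<cdot> copy_lang)"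
proof -
  have "\<exists>w \<in> {[(True, False)]} \<cdot> copy_lang. \<forall>q. qrun (block x @ q) w (q @ block (Suc x))" for x
  proof -
    obtain u where u: "u \<in> copy_lang" "\<And>q. qrun (block x @ q) u (q @ block x)"
      using copy_lang_complete by blast
    \<comment> \<open>The extra letter is written behind \<open>q\<close> before the copying starts,
      so it becomes the first letter of the new block.\<close>
    have "qrun (block x @ q) ((True, False) # u) (q @ block (Suc x))" for q
      using u(2)[of "q @ [False]"] by (auto simp: block_def intro: qrun_write)
    then show ?thesis using u(1) concI[of "[(True, False)]" "{[(True, False)]}" u] by auto
  qed
  moreover have "\<exists>x. consumed w = block x \<and> written w = block (Suc x)"
    if "w \<in> {[(True, False)]} \<cdot> copy_lang" for w
    using that copy_lang_sound by (fastforce simp: block_def elim!: concE)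
  ultimately show ?thesis
    unfolding block_impl_def by (auto intro!: regular_conc regular_single regular_copy_lang)
qed

lemma block_impl_dec: "block_impl {(Suc x, x) |x. True} ({[(False, False)]} \<cdot> copy_lang)"
proof -
  have "\<exists>w \<in> {[(False, False)]} \<cdot> copy_lang. \<forall>q. qrun (block (Suc x) @ q) w (q @ block x)" for x
  proof -
    obtain u where u: "u \<in> copy_lang" "\<And>q. qrun (block x @ q) u (q @ block x)"
      using copy_lang_complete by blast
    have "qrun (block (Suc x) @ q) ((False, False) # u) (q @ block x)" for q
      using u(2)[of q] by (auto simp: block_def intro: qrun_consume)
    then show ?thesis using u(1) concI[of "[(False, False)]" "{[(False, False)]}" u] by auto
  qed
  moreover have "\<exists>x. consumed w = block (Suc x) \<and> written w = block x"
    if "w \<in> {[(False, False)]} \<cdot> copy_lang" for w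
    using that copy_lang_sound by (fastforce simp: block_def elim!: concE)
  ultimately show ?thesis
    unfolding block_impl_def by (auto intro!: regular_conc regular_single regular_copy_lang)
qed

lemma block_impl_zero: "block_impl {(0, 0)} {[(False, True), (True, True)]}"
  unfolding block_impl_def by (auto simp: block_def regular_singleton intro!: qrun.intros)

text \<open>Each block is processed while it is at the front and its image joins the rear, so after
  one round the images stand behind \<open>q\<close> in the original order.\<close>

lemma block_impl_sequence:
  assumes "\<And>j. j < k \<Longrightarrow> block_impl (\<beta> j) (A j)"
  shows "\<exists>A. regular A \<and>
    (\<forall>\<nu> \<nu>'. (\<forall>j<k. (\<nu> j, \<nu>' j) \<in> \<beta> j) \<longrightarrow>
       (\<exists>w \<in> A. \<forall>q. qrun (blocks (map \<nu> [0..<k]) @ q) w (q @ blocks (map \<nu>' [0..<k])))) \<and>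
    (\<forall>w \<in> A. \<exists>us vs. length us = k \<and> length vs = k \<and> (\<forall>j<k. (us ! j, vs ! j) \<in> \<beta> j) \<and>
       consumed w = blocks us \<and> written w = blocks vs)"
  using assms
proof (induction k)
  case 0
  show ?case by (rule exI[of _ "{[]}"]) (auto intro: regular_Nil qrun_Nil)
next
  case (Suc k)
  then obtain B where B: "regular B"
    and B_complete: "\<And>\<nu> \<nu>'. (\<forall>j<k. (\<nu> j, \<nu>' j) \<in> \<beta> j) \<Longrightarrow>
       \<exists>w \<in> B. \<forall>q. qrun (blocks (map \<nu> [0..<k]) @ q) w (q @ blocks (map \<nu>' [0..<k]))"
    and B_sound: "\<And>w. w \<in> B \<Longrightarrow> \<exists>us vs. length us = k \<and> length vs = k \<and>
       (\<forall>j<k. (us ! j, vs ! j) \<in> \<beta> j) \<and> consumed w = blocks us \<and> written w = blocks vs"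
    by (metis less_Suc_eq)
  have Ak: "block_impl (\<beta> k) (A k)" using Suc.prems by simp
  show ?case
  proof (intro exI[of _ "B \<cdot> A k"] conjI allI impI ballI)
    show "regular (B \<cdot> A k)" using B Ak by (auto simp: block_impl_def intro: regular_conc)
  next
    fix \<nu> \<nu>' :: "nat \<Rightarrow> nat" assume *: "\<forall>j<Suc k. (\<nu> j, \<nu>' j) \<in> \<beta> j"
    from * B_complete obtain u where u: "u \<in> B"
      "\<And>q. qrun (blocks (map \<nu> [0..<k]) @ q) u (q @ blocks (map \<nu>' [0..<k]))"
      by (metis less_Suc_eq)
    from * Ak obtain v where v: "v \<in> A k" "\<And>q. qrun (block (\<nu> k) @ q) v (q @ block (\<nu>' k))"
      unfolding block_impl_def by blast
    \<comment> \<open>For \<open>u\<close> the rest of the queue begins with the unprocessed block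
      \<open>k\<close>; for \<open>v\<close> it ends with the images of the first \<open>k\<close>
      blocks.\<close>
    have "qrun (blocks (map \<nu> [0..<Suc k]) @ q) (u @ v) (q @ blocks (map \<nu>' [0..<Suc k]))" for q
      using qrun_append[OF u(2)[of "block (\<nu> k) @ q"]
          v(2)[of "q @ blocks (map \<nu>' [0..<k])", folded append.assoc]] by simp
    then show "\<exists>w \<in> B \<cdot> A k.
        \<forall>q. qrun (blocks (map \<nu> [0..<Suc k]) @ q) w (q @ blocks (map \<nu>' [0..<Suc k]))"
      using u(1) v(1) concI by blast
  next
    fix w assume "w \<in> B \<cdot> A k"
    then obtain u v where w: "w = u @ v" "u \<in> B" "v \<in> A k" by (rule concE)
    obtain us vs where us: "length us = k" "length vs = k" "\<forall>j<k. (us ! j, vs ! j) \<in> \<beta> j"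
      "consumed u = blocks us" "written u = blocks vs"
      using B_sound[OF w(2)] by blast
    obtain x y where xy: "(x, y) \<in> \<beta> k" "consumed v = block x" "written v = block y"
      using Ak w(3) unfolding block_impl_def by blast
    show "\<exists>us vs. length us = Suc k \<and> length vs = Suc k \<and>
       (\<forall>j<Suc k. (us ! j, vs ! j) \<in> \<beta> j) \<and> consumed w = blocks us \<and> written w = blocks vs"
      by (rule exI[of _ "us @ [x]"], rule exI[of _ "vs @ [y]"])
        (use us xy w in \<open>auto simp: nth_append less_Suc_eq\<close>)
  qed
qed

text \<open>Soundness is stated without reference to queue runs: in the cycles that are not
  directed, consumption may overtake writing, and only the two projections are known to agree.\<close>

definition transforms :: "nat \<Rightarrow> (nat \<Rightarrow> nat) rel \<Rightarrow> (bool \<times> bool) list \<Rightarrow> bool" where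
  "transforms r \<rho> w \<longleftrightarrow> (\<exists>us vs. length us = length vs \<and>
     consumed w = blocks us \<and> written w = blocks vs \<and>
     (\<forall>\<nu> \<nu>'. map \<nu> [0..<r] @ vs = us @ map \<nu>' [0..<r] \<longrightarrow> (\<forall>j\<ge>r. \<nu>' j = \<nu> j) \<longrightarrow> (\<nu>, \<nu>') \<in> \<rho>))"

lemma transforms_mono: "transforms r \<rho> w \<Longrightarrow> \<rho> \<subseteq> \<sigma> \<Longrightarrow> transforms r \<sigma> w"
  unfolding transforms_def by blast

lemma transforms_Nil: "transforms r Id []"
proof -
  have "\<nu> = \<nu>'" if "\<forall>j<r. \<nu> j = \<nu>' j" "\<forall>j\<ge>r. \<nu>' j = \<nu> j" for \<nu> \<nu>' :: "nat \<Rightarrow> nat"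
    using that by (metis ext not_le)
  then show ?thesis unfolding transforms_def by (intro exI[of _ "[]"]) auto
qed

lemma transforms_append:
  assumes "transforms r \<rho> u" "transforms r \<sigma> v"
  shows "transforms r (\<rho> O \<sigma>) (u @ v)"
proof -
  from assms(1) obtain us vs where u: "length us = length vs" "consumed u = blocks us"
    "written u = blocks vs"
    "\<And>\<nu> \<nu>'. map \<nu> [0..<r] @ vs = us @ map \<nu>' [0..<r] \<Longrightarrow> (\<forall>j\<ge>r. \<nu>' j = \<nu> j) \<Longrightarrow> (\<nu>, \<nu>') \<in> \<rho>"
    unfolding transforms_def by blast
  from assms(2) obtain us' vs' where v: "length us' = length vs'" "consumed v = blocks us'"
    "written v = blocks vs'"
    "\<And>\<nu> \<nu>'. map \<nu> [0..<r] @ vs' = us' @ map \<nu>' [0..<r] \<Longrightarrow> (\<forall>j\<ge>r. \<nu>' j = \<nu> j) \<Longrightarrow> (\<nu>, \<nu>') \<in> \<sigma>"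
    unfolding transforms_def by blast
  show ?thesis
    unfolding transforms_def
  proof (rule exI[of _ "us @ us'"], rule exI[of _ "vs @ vs'"], intro conjI allI impI)
    fix \<nu> \<nu>'' :: "nat \<Rightarrow> nat"
    assume eq: "map \<nu> [0..<r] @ vs @ vs' = (us @ us') @ map \<nu>'' [0..<r]"
      and rest: "\<forall>j\<ge>r. \<nu>'' j = \<nu> j"
    \<comment> \<open>The intermediate register contents are what remains when the blocks consumed
      by \<open>u\<close> are cut off from the front. As \<open>us\<close> and \<open>vs\<close> are
      equally long, exactly \<open>r\<close> numbers remain.\<close>
    define ys where "ys = drop (length us) (map \<nu> [0..<r] @ vs)"
    define \<nu>' where "\<nu>' j = (if j < r then ys ! j else \<nu> j)" for j
    have len: "length ys = r" using u(1) by (simp add: ys_def)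
    then have ys: "map \<nu>' [0..<r] = ys" by (auto intro!: nth_equalityI simp: \<nu>'_def)
    have "take (length us) ((map \<nu> [0..<r] @ vs) @ vs') = us"
      using eq by simp
    then have "take (length us) (map \<nu> [0..<r] @ vs) = us"
      using u(1) by (simp only: take_append) simp
    then have 1: "map \<nu> [0..<r] @ vs = us @ ys"
      unfolding ys_def by (metis append_take_drop_id)
    have "(map \<nu> [0..<r] @ vs) @ vs' = us @ us' @ map \<nu>'' [0..<r]"
      using eq by simp
    then have 2: "ys @ vs' = us' @ map \<nu>'' [0..<r]" unfolding 1 by simp
    have "(\<nu>, \<nu>') \<in> \<rho>" by (rule u(4)) (simp_all only: ys 1, simp add: \<nu>'_def)
    moreover have "(\<nu>', \<nu>'') \<in> \<sigma>"
      by (rule v(4)) (simp_all only: ys 2, simp add: \<nu>'_def rest)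
    ultimately show "(\<nu>, \<nu>'') \<in> \<rho> O \<sigma>" by blast
  qed (use u v in auto)
qed

definition queue_impl :: "nat \<Rightarrow> (nat \<Rightarrow> nat) rel \<Rightarrow> (bool \<times> bool) list set \<Rightarrow> bool" where
  "queue_impl r \<rho> A \<longleftrightarrow> regular A \<and>
     (\<forall>(\<nu>, \<nu>') \<in> \<rho>. \<exists>w \<in> A. qrun (blocks (map \<nu> [0..<r])) w (blocks (map \<nu>' [0..<r]))) \<and>
     (\<forall>w \<in> A. transforms r \<rho> w)"

lemma queue_impl_pointwise:
  assumes "\<And>j. j < r \<Longrightarrow> block_impl (\<beta> j) (A j)"
  shows "\<exists>A. queue_impl r {(\<nu>, \<nu>'). (\<forall>j<r. (\<nu> j, \<nu>' j) \<in> \<beta> j) \<and> (\<forall>j\<ge>r. \<nu>' j = \<nu> j)} A"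
proof -
  obtain A where A: "regular A"
    "\<And>\<nu> \<nu>'. (\<forall>j<r. (\<nu> j, \<nu>' j) \<in> \<beta> j) \<Longrightarrow>
       \<exists>w \<in> A. \<forall>q. qrun (blocks (map \<nu> [0..<r]) @ q) w (q @ blocks (map \<nu>' [0..<r]))"
    "\<And>w. w \<in> A \<Longrightarrow> \<exists>us vs. length us = r \<and> length vs = r \<and>
       (\<forall>j<r. (us ! j, vs ! j) \<in> \<beta> j) \<and> consumed w = blocks us \<and> written w = blocks vs"
    using block_impl_sequence[where k=r and A=A and \<beta>=\<beta>] assms by blast
  show ?thesis
    unfolding queue_impl_def
  proof (rule exI[of _ A], intro conjI ballI, goal_cases)
    case 1
    show ?case by fact
  next
    case (2 p)
    then obtain \<nu> \<nu>' where p: "p = (\<nu>, \<nu>')" "\<forall>j<r. (\<nu> j, \<nu>' j) \<in> \<beta> j" by blast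
    from A(2)[OF p(2)] obtain w where
      "w \<in> A" "qrun (blocks (map \<nu> [0..<r]) @ []) w ([] @ blocks (map \<nu>' [0..<r]))" by blast
    then show ?case using p(1) by auto
  next
    case (3 w)
    obtain us vs where us: "length us = r" "length vs = r" "\<forall>j<r. (us ! j, vs ! j) \<in> \<beta> j"
      "consumed w = blocks us" "written w = blocks vs"
      using A(3)[OF 3] by blast
    show ?case
      unfolding transforms_def
    proof (rule exI[of _ us], rule exI[of _ vs], intro conjI allI impI)
      fix \<nu> \<nu>' :: "nat \<Rightarrow> nat"
      assume eq: "map \<nu> [0..<r] @ vs = us @ map \<nu>' [0..<r]" and rest: "\<forall>j\<ge>r. \<nu>' j = \<nu> j"
      from eq us(1) have eqs: "us = map \<nu> [0..<r]" "vs = map \<nu>' [0..<r]"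
        by (auto simp: append_eq_append_conv)
      have "\<forall>j<r. (\<nu> j, \<nu>' j) \<in> \<beta> j" using us(3) unfolding eqs by auto
      with rest show "(\<nu>, \<nu>') \<in>
          {(\<nu>, \<nu>'). (\<forall>j<r. (\<nu> j, \<nu>' j) \<in> \<beta> j) \<and> (\<forall>j\<ge>r. \<nu>' j = \<nu> j)}" by auto
    qed (use us in auto)
  qed
qed

lemma queue_impl_Id: "queue_impl r Id {[]}"
  unfolding queue_impl_def by (auto intro: regular_Nil qrun_Nil transforms_Nil)

lemma queue_impl_empty: "queue_impl r {} {}"
  unfolding queue_impl_def by (auto intro: regular_empty)

lemma queue_impl_relcomp:
  assumes A: "queue_impl r \<rho> A" and B: "queue_impl r \<sigma> B"
  shows "queue_impl r (\<rho> O \<sigma>) (A \<cdot> B)"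
  unfolding queue_impl_def
proof (intro conjI ballI, goal_cases)
  case 1
  show ?case using A B by (auto simp: queue_impl_def intro: regular_conc)
next
  case (2 p)
  then obtain \<nu> \<nu>' \<nu>'' where p: "p = (\<nu>, \<nu>'')" "(\<nu>, \<nu>') \<in> \<rho>" "(\<nu>', \<nu>'') \<in> \<sigma>" by blast
  from A p(2) obtain u where
    "u \<in> A" "qrun (blocks (map \<nu> [0..<r])) u (blocks (map \<nu>' [0..<r]))"
    unfolding queue_impl_def by blast
  moreover from B p(3) obtain v where
    "v \<in> B" "qrun (blocks (map \<nu>' [0..<r])) v (blocks (map \<nu>'' [0..<r]))"
    unfolding queue_impl_def by blast
  ultimately show ?case using p(1) by (auto intro: qrun_append concI)
next
  case (3 w)
  then show ?case using A B by (auto simp: queue_impl_def elim!: concE intro: transforms_append)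
qed

lemma queue_impl_rtrancl:
  assumes A: "queue_impl r \<rho> A"
  shows "queue_impl r (\<rho>\<^sup>*) (star A)"
  unfolding queue_impl_def
proof (intro conjI ballI, goal_cases)
  case 1
  show ?case using A by (auto simp: queue_impl_def intro: regular_star)
next
  case (2 p)
  have "\<exists>w \<in> star A. qrun (blocks (map \<nu> [0..<r])) w (blocks (map \<nu>' [0..<r]))"
    if "(\<nu>, \<nu>') \<in> \<rho>\<^sup>*" for \<nu> \<nu>'
    using that
  proof (induction rule: converse_rtrancl_induct)
    case base
    show ?case by (auto intro: star_Nil qrun_Nil)
  next
    case (step \<nu>1 \<nu>2)
    from A step(1) obtain u where
      "u \<in> A" "qrun (blocks (map \<nu>1 [0..<r])) u (blocks (map \<nu>2 [0..<r]))"
      unfolding queue_impl_def by blast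
    with step(3) show ?case by (auto intro: star_app qrun_append)
  qed
  with 2 show ?case by auto
next
  case (3 w)
  then show ?case
  proof (induction rule: star.induct)
    case star_Nil
    show ?case by (rule transforms_mono[OF transforms_Nil]) auto
  next
    case (star_app u v)
    have "transforms r (\<rho> O \<rho>\<^sup>*) (u @ v)"
      using A star_app by (auto simp: queue_impl_def intro: transforms_append)
    then show ?case by (rule transforms_mono) (auto intro: converse_rtrancl_into_rtrancl)
  qed
qed

section \<open>Counter programs\<close>

definition inc :: "nat \<Rightarrow> (nat \<Rightarrow> nat) rel" where
  "inc i = {(\<nu>, \<nu>(i := Suc (\<nu> i))) |\<nu>. True}"

definition zero_test :: "nat \<Rightarrow> (nat \<Rightarrow> nat) rel" where
  "zero_test i = {(\<nu>, \<nu>) |\<nu>. \<nu> i = 0}"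

text \<open>Divergence and a blocked instruction are both the absence of a successor:
  \<open>cp_empty\<close> is the undefined program, and the converse of \<open>inc i\<close> is a
  decrement that blocks at zero.\<close>

inductive counter_prog :: "nat \<Rightarrow> (nat \<Rightarrow> nat) rel \<Rightarrow> bool" for r where
  cp_empty: "counter_prog r {}"
| cp_Id: "counter_prog r Id"
| cp_inc: "i < r \<Longrightarrow> counter_prog r (inc i)"
| cp_dec: "i < r \<Longrightarrow> counter_prog r ((inc i)\<inverse>)"
| cp_zero: "i < r \<Longrightarrow> counter_prog r (zero_test i)"
| cp_relcomp: "counter_prog r \<rho> \<Longrightarrow> counter_prog r \<sigma> \<Longrightarrow> counter_prog r (\<rho> O \<sigma>)"
| cp_rtrancl: "counter_prog r \<rho> \<Longrightarrow> counter_prog r (\<rho>\<^sup>*)"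

lemma counter_prog_mono: "counter_prog r \<rho> \<Longrightarrow> r \<le> r' \<Longrightarrow> counter_prog r' \<rho>"
  by (induction rule: counter_prog.induct) (auto intro: counter_prog.intros)

text \<open>A single instruction is one rotation of the queue that acts by \<open>\<beta>\<close> on
  block \<open>i\<close> and copies every other block. This serves increment, decrement and zero
  test alike.\<close>

lemma queue_impl_one_register:
  assumes "i < r" "block_impl \<beta> A"
  shows "\<exists>A. queue_impl r {(\<nu>, \<nu>') |\<nu> \<nu>'. \<exists>y. (\<nu> i, y) \<in> \<beta> \<and> \<nu>' = \<nu>(i := y)} A"
proof -
  have "{(\<nu>, \<nu>') |\<nu> \<nu>'. \<exists>y. (\<nu> i, y) \<in> \<beta> \<and> \<nu>' = \<nu>(i := y)} =
    {(\<nu>, \<nu>'). (\<forall>j<r. (\<nu> j, \<nu>' j) \<in> (if j = i then \<beta> else Id)) \<and> (\<forall>j\<ge>r. \<nu>' j = \<nu> j)}"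
    (is "?L = ?R")
  proof (intro equalityI subsetI)
    fix p assume "p \<in> ?R"
    then obtain \<nu> \<nu>' where p: "p = (\<nu>, \<nu>')"
      "\<And>j. j < r \<Longrightarrow> (\<nu> j, \<nu>' j) \<in> (if j = i then \<beta> else Id)" "\<And>j. j \<ge> r \<Longrightarrow> \<nu>' j = \<nu> j" by auto
    have "\<nu>' j = \<nu> j" if "j \<noteq> i" for j
      using p(2)[of j] p(3)[of j] that by (cases "j < r") auto
    then have "\<nu>' = \<nu>(i := \<nu>' i)" by auto
    then show "p \<in> ?L" using p(1) p(2)[OF assms(1)] by auto
  qed (use assms(1) in auto)
  moreover have "\<exists>A. queue_impl r ?R A"
    by (rule queue_impl_pointwise[where A="\<lambda>j. if j = i then A else copy_lang"])
      (use assms(2) block_impl_copy in auto)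
  ultimately show ?thesis by simp
qed

lemma counter_prog_queue_impl: "counter_prog r \<rho> \<Longrightarrow> \<exists>A. queue_impl r \<rho> A"
proof (induction rule: counter_prog.induct)
  case (cp_inc i)
  have "inc i = {(\<nu>, \<nu>') |\<nu> \<nu>'. \<exists>y. (\<nu> i, y) \<in> {(x, Suc x) |x. True} \<and> \<nu>' = \<nu>(i := y)}"
    by (auto simp: inc_def)
  then show ?case using queue_impl_one_register[OF cp_inc block_impl_inc] by simp
next
  case (cp_dec i)
  have "(inc i)\<inverse> = {(\<nu>, \<nu>') |\<nu> \<nu>'. \<exists>y. (\<nu> i, y) \<in> {(Suc x, x) |x. True} \<and> \<nu>' = \<nu>(i := y)}"
    by (force simp: inc_def fun_eq_iff)
  then show ?case using queue_impl_one_register[OF cp_dec block_impl_dec] by simp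
next
  case (cp_zero i)
  have "zero_test i = {(\<nu>, \<nu>') |\<nu> \<nu>'. \<exists>y. (\<nu> i, y) \<in> {(0, 0)} \<and> \<nu>' = \<nu>(i := y)}"
    by (auto simp: zero_test_def intro: fun_upd_triv[symmetric] fun_upd_triv)
      (metis fun_upd_triv)+
  then show ?case using queue_impl_one_register[OF cp_zero block_impl_zero] by simp
qed (blast intro: queue_impl_empty queue_impl_Id queue_impl_relcomp queue_impl_rtrancl)+

definition program :: "(nat \<Rightarrow> nat) rel \<Rightarrow> bool" where
  "program \<rho> \<longleftrightarrow> (\<exists>r. counter_prog r \<rho>)"

lemma program_basic:
  "program {}" "program Id" "program (inc i)" "program ((inc i)\<inverse>)" "program (zero_test i)"
  unfolding program_def by (blast intro: counter_prog.intros lessI)+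

lemma program_relcomp: "program \<rho> \<Longrightarrow> program \<sigma> \<Longrightarrow> program (\<rho> O \<sigma>)"
  unfolding program_def by (meson counter_prog_mono cp_relcomp max.cobounded1 max.cobounded2)

lemma program_rtrancl: "program \<rho> \<Longrightarrow> program (\<rho>\<^sup>*)"
  unfolding program_def by (blast intro: cp_rtrancl)

section \<open>Transfer, copying and comparison of registers\<close>

definition shift :: "nat set \<Rightarrow> nat set \<Rightarrow> (nat \<Rightarrow> nat) rel" where
  "shift S D = {(\<nu>, \<nu>'). (\<forall>s \<in> S. 0 < \<nu> s) \<and>
     \<nu>' = (\<lambda>j. if j \<in> S then \<nu> j - 1 else if j \<in> D then Suc (\<nu> j) else \<nu> j)}"

text \<open>All registers in \<open>S\<close> must hold the same number, so that a flush from two registers is also an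
  equality test.\<close>

definition flush :: "nat set \<Rightarrow> nat set \<Rightarrow> (nat \<Rightarrow> nat) rel" where
  "flush S D = {(\<nu>, \<nu>'). \<exists>k. (\<forall>s \<in> S. \<nu> s = k) \<and>
     \<nu>' = (\<lambda>j. if j \<in> S then 0 else if j \<in> D then \<nu> j + k else \<nu> j)}"

lemma program_shift:
  assumes "finite S" "finite D" "S \<inter> D = {}"
  shows "program (shift S D)"
  using assms
proof (induction S rule: finite_induct)
  case empty
  from empty(1) show ?case
  proof (induction D rule: finite_induct)
    case empty
    have "shift {} {} = Id" by (auto simp: shift_def)
    then show ?case by (simp add: program_basic)
  next
    case (insert d D)
    have "shift {} (insert d D) = inc d O shift {} D"
      using insert(2) by (fastforce simp: shift_def inc_def fun_eq_iff)
    then show ?case using insert by (simp add: program_basic program_relcomp)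
  qed
next
  case (insert s S)
  have "shift (insert s S) D = (inc s)\<inverse> O shift S D" (is "?L = ?R")
  proof (intro equalityI subsetI)
    fix p assume "p \<in> ?L"
    then obtain \<nu> \<nu>' where p: "p = (\<nu>, \<nu>')" "\<forall>s \<in> insert s S. 0 < \<nu> s"
      "\<nu>' = (\<lambda>j. if j \<in> insert s S then \<nu> j - 1 else if j \<in> D then Suc (\<nu> j) else \<nu> j)"
      by (auto simp: shift_def)
    have "(\<nu>, \<nu>(s := \<nu> s - 1)) \<in> (inc s)\<inverse>"
      using p(2) by (auto simp: inc_def intro!: exI[of _ "\<nu>(s := \<nu> s - 1)"])
    moreover have "(\<nu>(s := \<nu> s - 1), \<nu>') \<in> shift S D"
      using p(2,3) insert by (auto simp: shift_def fun_eq_iff)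
    ultimately show "p \<in> ?R" using p(1) by blast
  qed (use insert in \<open>auto simp: shift_def inc_def fun_eq_iff\<close>)
  then show ?case using insert by (simp add: program_basic program_relcomp)
qed

lemma program_zero_tests: "finite S \<Longrightarrow> program {(\<nu>, \<nu>) |\<nu>. \<forall>s \<in> S. \<nu> s = 0}"
proof (induction S rule: finite_induct)
  case empty
  have "{(\<nu>, \<nu>) |\<nu> :: nat \<Rightarrow> nat. \<forall>s \<in> {}. \<nu> s = 0} = Id" by auto
  then show ?case using program_basic(2) by simp
next
  case (insert s S)
  have "{(\<nu>, \<nu>) |\<nu>. \<forall>s \<in> insert s S. \<nu> s = 0} = zero_test s O {(\<nu>, \<nu>) |\<nu>. \<forall>s \<in> S. \<nu> s = 0}"
    by (auto simp: zero_test_def)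
  then show ?case using insert by (simp add: program_basic program_relcomp)
qed

lemma rtrancl_shift:
  assumes "S \<inter> D = {}"
  shows "(\<nu>, \<nu>') \<in> (shift S D)\<^sup>* \<longleftrightarrow> (\<exists>k. (\<forall>s \<in> S. k \<le> \<nu> s) \<and>
     \<nu>' = (\<lambda>j. if j \<in> S then \<nu> j - k else if j \<in> D then \<nu> j + k else \<nu> j))" (is "?L \<longleftrightarrow> ?R")
proof
  assume ?L
  then show ?R
  proof (induction rule: rtrancl_induct)
    case base
    show ?case by (intro exI[of _ 0]) auto
  next
    case (step \<nu>1 \<nu>2)
    from step(3) obtain k where k: "\<forall>s \<in> S. k \<le> \<nu> s"
      "\<nu>1 = (\<lambda>j. if j \<in> S then \<nu> j - k else if j \<in> D then \<nu> j + k else \<nu> j)" by blast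
    with step(2) assms show ?case
      by (intro exI[of _ "Suc k"]) (force simp: shift_def fun_eq_iff)
  qed
next
  assume ?R
  then obtain k where "\<forall>s \<in> S. k \<le> \<nu> s"
    "\<nu>' = (\<lambda>j. if j \<in> S then \<nu> j - k else if j \<in> D then \<nu> j + k else \<nu> j)" by blast
  then show ?L
  proof (induction k arbitrary: \<nu>')
    case 0
    then have "\<nu>' = \<nu>" by (auto simp: fun_eq_iff)
    then show ?case by simp
  next
    case (Suc k)
    let ?\<nu>1 = "\<lambda>j. if j \<in> S then \<nu> j - k else if j \<in> D then \<nu> j + k else \<nu> j"
    have "(\<nu>, ?\<nu>1) \<in> (shift S D)\<^sup>*" using Suc by (intro Suc.IH) auto
    moreover have "(?\<nu>1, \<nu>') \<in> shift S D"
      using Suc.prems by (fastforce simp: shift_def fun_eq_iff)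
    ultimately show ?case by (rule rtrancl_into_rtrancl)
  qed
qed

text \<open>The iteration of \<open>shift\<close> may stop anywhere. The zero tests behind it keep
  only the number of passes that empties all of \<open>S\<close>, which therefore equals the
  contents of each register in \<open>S\<close>.\<close>

lemma program_flush:
  assumes "finite S" "finite D" "S \<inter> D = {}" "S \<noteq> {}"
  shows "program (flush S D)"
proof -
  have "flush S D = (shift S D)\<^sup>* O {(\<nu>, \<nu>) |\<nu>. \<forall>s \<in> S. \<nu> s = 0}" (is "?L = ?R")
  proof (intro equalityI subsetI)
    fix p assume "p \<in> ?L"
    then obtain \<nu> \<nu>' k where p: "p = (\<nu>, \<nu>')" "\<forall>s \<in> S. \<nu> s = k"
      "\<nu>' = (\<lambda>j. if j \<in> S then 0 else if j \<in> D then \<nu> j + k else \<nu> j)"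
      by (auto simp: flush_def)
    have "(\<nu>, \<nu>') \<in> (shift S D)\<^sup>*"
      unfolding rtrancl_shift[OF assms(3)] using p(2,3) by (intro exI[of _ k]) (auto simp: fun_eq_iff)
    moreover have "\<forall>s \<in> S. \<nu>' s = 0" using p(3) by simp
    ultimately show "p \<in> ?R" using p(1) by blast
  next
    fix p assume "p \<in> ?R"
    then obtain \<nu> \<nu>' where p: "p = (\<nu>, \<nu>')" "(\<nu>, \<nu>') \<in> (shift S D)\<^sup>*" "\<forall>s \<in> S. \<nu>' s = 0"
      by blast
    from p(2) obtain k where k: "\<forall>s \<in> S. k \<le> \<nu> s"
      "\<nu>' = (\<lambda>j. if j \<in> S then \<nu> j - k else if j \<in> D then \<nu> j + k else \<nu> j)"
      unfolding rtrancl_shift[OF assms(3)] by blast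
    have "\<forall>s \<in> S. \<nu> s = k"
      using k p(3) by (metis diff_is_0_eq le_antisym)
    then show "p \<in> ?L" using p(1) k(2) by (auto simp: flush_def fun_eq_iff intro!: exI[of _ k])
  qed
  then show ?thesis
    using assms by (simp add: program_relcomp program_rtrancl program_shift program_zero_tests)
qed

lemma flush_iff:
  assumes "s \<in> S"
  shows "(\<nu>, \<nu>') \<in> flush S D \<longleftrightarrow> (\<forall>s' \<in> S. \<nu> s' = \<nu> s) \<and>
    \<nu>' = (\<lambda>j. if j \<in> S then 0 else if j \<in> D then \<nu> j + \<nu> s else \<nu> j)"
  using assms unfolding flush_def by auto

lemma flush_clear: "(\<nu>, \<nu>') \<in> flush {i} {} \<longleftrightarrow> \<nu>' = \<nu>(i := 0)"
proof -
  have "(\<lambda>j. if j \<in> {i} then 0 else if j \<in> {} then \<nu> j + \<nu> i else \<nu> j) = \<nu>(i := 0)"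
    by (rule ext) simp
  then show ?thesis by (simp add: flush_iff[of i])
qed

lemma flush_move:
  assumes "i \<noteq> j"
  shows "(\<nu>, \<nu>') \<in> flush {i} {j} \<longleftrightarrow> \<nu>' = \<nu>(i := 0, j := \<nu> j + \<nu> i)"
proof -
  have "(\<lambda>k. if k \<in> {i} then 0 else if k \<in> {j} then \<nu> k + \<nu> i else \<nu> k) =
      \<nu>(i := 0, j := \<nu> j + \<nu> i)"
    using assms by (intro ext) simp
  then show ?thesis unfolding flush_iff[OF singletonI] by simp
qed

text \<open>A transfer destroys its source, so the number is sent to \<open>j\<close> and to the
  scratch register \<open>t\<close> at once and then brought back from \<open>t\<close>.\<close>

lemma copy_register:
  assumes "i \<noteq> j" "t \<noteq> i" "t \<noteq> j" "\<nu> t = 0"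
  shows "(\<nu>, \<nu>') \<in> flush {i} {j, t} O flush {t} {i} \<longleftrightarrow> \<nu>' = \<nu>(j := \<nu> j + \<nu> i)"
proof -
  let ?\<nu>1 = "\<nu>(i := 0, j := \<nu> j + \<nu> i, t := \<nu> i)"
  have "(\<lambda>k. if k \<in> {i} then 0 else if k \<in> {j, t} then \<nu> k + \<nu> i else \<nu> k) = ?\<nu>1"
    using assms by (intro ext) simp
  then have "(\<nu>, \<nu>1) \<in> flush {i} {j, t} \<longleftrightarrow> \<nu>1 = ?\<nu>1" for \<nu>1
    unfolding flush_iff[OF singletonI] by simp
  then have "(\<nu>, \<nu>') \<in> flush {i} {j, t} O flush {t} {i} \<longleftrightarrow> (?\<nu>1, \<nu>') \<in> flush {t} {i}"
    by (simp add: relcomp_unfold)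
  also have "?\<nu>1(t := 0, i := ?\<nu>1 i + ?\<nu>1 t) = \<nu>(j := \<nu> j + \<nu> i)"
    using assms by (intro ext) simp
  then have "(?\<nu>1, \<nu>') \<in> flush {t} {i} \<longleftrightarrow> \<nu>' = \<nu>(j := \<nu> j + \<nu> i)"
    unfolding flush_move[OF assms(2)] by simp
  finally show ?thesis .
qed

text \<open>Emptying \<open>i\<close> and \<open>j\<close> in lockstep succeeds only if they agree;
  the common value survives in \<open>t\<close> and is restored to both.\<close>

lemma equality_test:
  assumes "i \<noteq> j" "t \<noteq> i" "t \<noteq> j" "\<nu> t = 0"
  shows "(\<nu>, \<nu>') \<in> flush {i, j} {t} O flush {t} {i, j} \<longleftrightarrow> \<nu> i = \<nu> j \<and> \<nu>' = \<nu>"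
proof -
  let ?\<nu>1 = "\<nu>(i := 0, j := 0, t := \<nu> i)"
  have "(\<lambda>k. if k \<in> {i, j} then 0 else if k \<in> {t} then \<nu> k + \<nu> i else \<nu> k) = ?\<nu>1"
    using assms by (intro ext) simp
  then have 1: "(\<nu>, \<nu>1) \<in> flush {i, j} {t} \<longleftrightarrow> \<nu> i = \<nu> j \<and> \<nu>1 = ?\<nu>1" for \<nu>1
    unfolding flush_iff[OF insertI1] by auto
  have "(\<lambda>k. if k \<in> {t} then 0 else if k \<in> {i, j} then ?\<nu>1 k + ?\<nu>1 t else ?\<nu>1 k) = \<nu>(j := \<nu> i)"
    using assms by (intro ext) simp
  then have 2: "(?\<nu>1, \<nu>') \<in> flush {t} {i, j} \<longleftrightarrow> \<nu>' = \<nu>(j := \<nu> i)"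
    unfolding flush_iff[OF singletonI] by simp
  have "(\<nu>, \<nu>') \<in> flush {i, j} {t} O flush {t} {i, j} \<longleftrightarrow> \<nu> i = \<nu> j \<and> \<nu>' = \<nu>(j := \<nu> i)"
    using 1 2 by (simp add: relcomp_unfold)
  then show ?thesis by (metis fun_upd_triv)
qed

section \<open>Recursive functions as counter programs\<close>

lemma reval_RZero_iff: "reval RZero xs z \<longleftrightarrow> z = 0"
  by (auto elim: reval.cases intro: reval_zero)

lemma reval_RSucc_iff: "reval RSucc xs z \<longleftrightarrow> xs \<noteq> [] \<and> z = Suc (hd xs)"
  by (cases xs) (auto elim: reval.cases intro: reval_succ)

lemma reval_RProj_iff: "reval (RProj i) xs z \<longleftrightarrow> i < length xs \<and> z = xs ! i"
  by (auto elim: reval.cases intro: reval_proj)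

lemma reval_RComp_iff:
  "reval (RComp f gs) xs z \<longleftrightarrow> (\<exists>ys. list_all2 (\<lambda>g y. reval g xs y) gs ys \<and> reval f ys z)"
  by (auto elim: reval.cases intro: reval_comp)

lemma reval_RPrim_0_iff: "reval (RPrim f g) (0 # xs) z \<longleftrightarrow> reval f xs z"
  by (auto elim: reval.cases intro: reval_prim0)

lemma reval_RPrim_Suc_iff:
  "reval (RPrim f g) (Suc n # xs) z \<longleftrightarrow> (\<exists>y. reval (RPrim f g) (n # xs) y \<and> reval g (y # n # xs) z)"
  by (auto elim: reval.cases intro: reval_primS)

lemma reval_RPrim_Nil: "\<not> reval (RPrim f g) [] z"
  by (auto elim: reval.cases)

lemma reval_RMin_iff:
  "reval (RMin f) xs n \<longleftrightarrow> reval f (n # xs) 0 \<and> (\<forall>k<n. \<exists>y. y \<noteq> 0 \<and> reval f (k # xs) y)"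
  by (auto elim: reval.cases intro: reval_min)

lemma relcomp_iff: "(x, z) \<in> \<rho> O \<sigma> \<longleftrightarrow> (\<exists>y. (x, y) \<in> \<rho> \<and> (y, z) \<in> \<sigma>)"
  by blast

lemma relcomp_iff_ex:
  assumes "\<And>y. (x, y) \<in> \<rho> \<longleftrightarrow> (\<exists>a. P a \<and> y = g a)"
  shows "(x, z) \<in> \<rho> O \<sigma> \<longleftrightarrow> (\<exists>a. P a \<and> (g a, z) \<in> \<sigma>)"
  unfolding relcomp_iff assms by blast

text \<open>The registers from \<open>t\<close> on are scratch space, zero before and after the computation.\<close>

definition implements :: "recf \<Rightarrow> nat list \<Rightarrow> nat \<Rightarrow> nat \<Rightarrow> (nat \<Rightarrow> nat) rel \<Rightarrow> bool" where
  "implements f ins out t \<rho> \<longleftrightarrow> program \<rho> \<and>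
     (\<forall>\<nu> \<nu>'. (\<forall>j\<ge>t. \<nu> j = 0) \<longrightarrow> \<nu> out = 0 \<longrightarrow>
        ((\<nu>, \<nu>') \<in> \<rho> \<longleftrightarrow> (\<exists>z. reval f (map \<nu> ins) z \<and> \<nu>' = \<nu>(out := z))))"

lemma implementsD:
  assumes "implements f ins out t \<rho>"
  shows "program \<rho>"
    "\<And>\<nu> \<nu>'. (\<And>j. t \<le> j \<Longrightarrow> \<nu> j = 0) \<Longrightarrow> \<nu> out = 0 \<Longrightarrow>
       (\<nu>, \<nu>') \<in> \<rho> \<longleftrightarrow> (\<exists>z. reval f (map \<nu> ins) z \<and> \<nu>' = \<nu>(out := z))"
  using assms unfolding implements_def by auto

text \<open>Arbitrary placement of inputs, output and scratch space is what the induction needs: the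
  parts of a composition or recursion read their arguments from, and leave their results in,
  registers chosen by the calling program.\<close>

definition implementable :: "recf \<Rightarrow> bool" where
  "implementable f \<longleftrightarrow> (\<forall>ins out t. (\<forall>i \<in> set ins. i < t) \<longrightarrow> out < t \<longrightarrow> out \<notin> set ins \<longrightarrow>
     (\<exists>\<rho>. implements f ins out t \<rho>))"

lemma implementableD:
  assumes "implementable f" "\<And>i. i \<in> set ins \<Longrightarrow> i < t" "out < t" "out \<notin> set ins"
  obtains \<rho> where "implements f ins out t \<rho>"
  using assms unfolding implementable_def by blast

lemma program_copy: "i < t \<Longrightarrow> j < t \<Longrightarrow> i \<noteq> j \<Longrightarrow> program (flush {i} {j, t} O flush {t} {i})"
  by (intro program_relcomp program_flush) auto

lemma implementable_RZero: "implementable RZero"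
  unfolding implementable_def implements_def
proof (intro allI impI, rule exI[of _ Id], intro conjI allI impI)
  fix \<nu> \<nu>' :: "nat \<Rightarrow> nat" and out ins assume "\<nu> out = 0"
  then have "\<nu>(out := 0) = \<nu>" by auto
  then show "(\<nu>, \<nu>') \<in> Id \<longleftrightarrow> (\<exists>z. reval RZero (map \<nu> ins) z \<and> \<nu>' = \<nu>(out := z))"
    by (auto simp: reval_RZero_iff)
qed (rule program_basic)

lemma implementable_RProj: "implementable (RProj i)"
  unfolding implementable_def
proof (intro allI impI)
  fix ins :: "nat list" and out t :: nat
  assume *: "\<forall>i \<in> set ins. i < t" "out < t" "out \<notin> set ins"
  show "\<exists>\<rho>. implements (RProj i) ins out t \<rho>"
  proof (cases "i < length ins")
    case True
    then have i: "ins ! i < t" "ins ! i \<noteq> out" using * by auto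
    have "implements (RProj i) ins out t (flush {ins ! i} {out, t} O flush {t} {ins ! i})"
      unfolding implements_def
      using i *(2) True
      by (intro conjI allI impI program_copy) (auto simp: copy_register reval_RProj_iff)
    then show ?thesis by blast
  next
    case False
    then have "implements (RProj i) ins out t {}"
      by (auto simp: implements_def program_basic reval_RProj_iff)
    then show ?thesis by blast
  qed
qed

lemma implementable_RSucc: "implementable RSucc"
  unfolding implementable_def
proof (intro allI impI)
  fix ins :: "nat list" and out t :: nat
  assume *: "\<forall>i \<in> set ins. i < t" "out < t" "out \<notin> set ins"
  show "\<exists>\<rho>. implements RSucc ins out t \<rho>"
  proof (cases ins)
    case Nil
    then have "implements RSucc ins out t {}"
      by (auto simp: implements_def program_basic reval_RSucc_iff)
    then show ?thesis by blast
  next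
    case (Cons i js)
    let ?\<rho> = "(flush {i} {out, t} O flush {t} {i}) O inc out"
    have "implements RSucc ins out t ?\<rho>"
      unfolding implements_def
    proof (intro conjI allI impI)
      show "program ?\<rho>"
        using * Cons by (intro program_relcomp[OF program_copy program_basic(3)]) auto
    next
      fix \<nu> \<nu>' :: "nat \<Rightarrow> nat" assume \<nu>: "\<forall>j\<ge>t. \<nu> j = 0" "\<nu> out = 0"
      have "(\<nu>, \<nu>1) \<in> flush {i} {out, t} O flush {t} {i} \<longleftrightarrow> \<nu>1 = \<nu>(out := \<nu> i)" for \<nu>1
        using * Cons \<nu> by (subst copy_register) auto
      then have "(\<nu>, \<nu>') \<in> ?\<rho> \<longleftrightarrow> (\<nu>(out := \<nu> i), \<nu>') \<in> inc out"
        unfolding relcomp_iff[of _ _ _ "inc out"] by simp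
      also have "\<dots> \<longleftrightarrow> \<nu>' = \<nu>(out := Suc (\<nu> i))"
        by (auto simp: inc_def)
      finally show "(\<nu>, \<nu>') \<in> ?\<rho> \<longleftrightarrow> (\<exists>z. reval RSucc (map \<nu> ins) z \<and> \<nu>' = \<nu>(out := z))"
        using Cons by (simp add: reval_RSucc_iff)
    qed
    then show ?thesis by blast
  qed
qed

fun store :: "(nat \<Rightarrow> nat) \<Rightarrow> nat \<Rightarrow> nat list \<Rightarrow> nat \<Rightarrow> nat" where
  "store \<nu> s [] = \<nu>"
| "store \<nu> s (y # ys) = store (\<nu>(s := y)) (Suc s) ys"

lemma store_outside: "j < s \<or> s + length ys \<le> j \<Longrightarrow> store \<nu> s ys j = \<nu> j"
  by (induction ys arbitrary: \<nu> s) auto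

lemma store_inside: "map (store \<nu> s ys) [s..<s + length ys] = ys"
proof (induction ys arbitrary: \<nu> s)
  case (Cons y ys)
  have eq: "[s..<s + length (y # ys)] = s # [Suc s..<Suc s + length ys]"
    by (subst upt_conv_Cons) auto
  show ?case
    unfolding eq using Cons[of "\<nu>(s := y)" "Suc s"] by (simp add: store_outside fun_upd_def del: upt_Suc)
qed simp

text \<open>Result number \<open>k\<close> goes to register \<open>s + k\<close>, and its program
  treats everything above as scratch. The inputs lie below \<open>s\<close> and stay intact for the
  remaining functions.\<close>

lemma implements_list:
  assumes "\<And>g. g \<in> set gs \<Longrightarrow> implementable g" "\<And>i. i \<in> set ins \<Longrightarrow> i < s"
  shows "\<exists>\<rho>. program \<rho> \<and> (\<forall>\<nu> \<nu>'. (\<forall>j\<ge>s. \<nu> j = 0) \<longrightarrow> ((\<nu>, \<nu>') \<in> \<rho> \<longleftrightarrow>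
    (\<exists>ys. list_all2 (\<lambda>g y. reval g (map \<nu> ins) y) gs ys \<and> \<nu>' = store \<nu> s ys)))"
  using assms
proof (induction gs arbitrary: s)
  case Nil
  show ?case by (rule exI[of _ Id]) (auto intro: program_basic)
next
  case (Cons g gs)
  obtain \<rho> where \<rho>: "implements g ins s (Suc s) \<rho>"
    using implementableD[of g ins "Suc s" s] Cons.prems by (metis less_Suc_eq list.set_intros(1) less_irrefl)
  obtain \<sigma> where \<sigma>: "program \<sigma>" "\<And>\<nu> \<nu>'. (\<forall>j\<ge>Suc s. \<nu> j = 0) \<Longrightarrow> (\<nu>, \<nu>') \<in> \<sigma> \<longleftrightarrow>
    (\<exists>ys. list_all2 (\<lambda>g y. reval g (map \<nu> ins) y) gs ys \<and> \<nu>' = store \<nu> (Suc s) ys)"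
    using Cons.IH[of "Suc s"] Cons.prems by (metis less_Suc_eq list.set_intros(2))
  show ?case
  proof (rule exI[of _ "\<rho> O \<sigma>"], intro conjI allI impI)
    show "program (\<rho> O \<sigma>)" using implementsD(1)[OF \<rho>] \<sigma>(1) by (rule program_relcomp)
  next
    fix \<nu> \<nu>' :: "nat \<Rightarrow> nat" assume \<nu>: "\<forall>j\<ge>s. \<nu> j = 0"
    have ins: "map (\<nu>(s := y)) ins = map \<nu> ins" for y using Cons.prems(2) by auto
    have \<sigma>y: "(\<nu>(s := y), \<nu>') \<in> \<sigma> \<longleftrightarrow> (\<exists>ys. list_all2 (\<lambda>g y. reval g (map \<nu> ins) y) gs ys \<and>
        \<nu>' = store (\<nu>(s := y)) (Suc s) ys)" for y
      using \<sigma>(2)[of "\<nu>(s := y)"] \<nu> unfolding ins by simp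
    have "(\<nu>, \<nu>') \<in> \<rho> O \<sigma> \<longleftrightarrow> (\<exists>y. reval g (map \<nu> ins) y \<and> (\<nu>(s := y), \<nu>') \<in> \<sigma>)"
      using implementsD(2)[OF \<rho>, of \<nu>] \<nu> by (auto simp: relcomp_unfold)
    also have "\<dots> \<longleftrightarrow> (\<exists>y. reval g (map \<nu> ins) y \<and>
        (\<exists>ys. list_all2 (\<lambda>g y. reval g (map \<nu> ins) y) gs ys \<and> \<nu>' = store (\<nu>(s := y)) (Suc s) ys))"
      by (simp only: \<sigma>y)
    also have "\<dots> \<longleftrightarrow>
        (\<exists>ys. list_all2 (\<lambda>g y. reval g (map \<nu> ins) y) (g # gs) ys \<and> \<nu>' = store \<nu> s ys)"
      by (force simp: list_all2_Cons1)
    finally show "(\<nu>, \<nu>') \<in> \<rho> O \<sigma> \<longleftrightarrow>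
      (\<exists>ys. list_all2 (\<lambda>g y. reval g (map \<nu> ins) y) (g # gs) ys \<and> \<nu>' = store \<nu> s ys)" .
  qed
qed

lemma program_clear_range:
  "program {(\<nu>, \<nu>'). \<nu>' = (\<lambda>j. if s \<le> j \<and> j < s + m then 0 else \<nu> j)}"
proof (induction m)
  case 0
  have "{(\<nu>, \<nu>'). \<nu>' = (\<lambda>j. if s \<le> j \<and> j < s + 0 then 0 else \<nu> j)} = (Id :: (nat \<Rightarrow> nat) rel)"
    by auto
  then show ?case using program_basic(2) by simp
next
  case (Suc m)
  have "(\<lambda>j. if s \<le> j \<and> j < s + Suc m then 0 else \<nu> j) =
      (\<lambda>j. if s \<le> j \<and> j < s + m then 0 else \<nu> j)(s + m := 0)" for \<nu> :: "nat \<Rightarrow> nat"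
    by (intro ext) auto
  then have "{(\<nu>, \<nu>'). \<nu>' = (\<lambda>j. if s \<le> j \<and> j < s + Suc m then 0 else \<nu> j)} =
      {(\<nu>, \<nu>'). \<nu>' = (\<lambda>j. if s \<le> j \<and> j < s + m then 0 else \<nu> j)} O flush {s + m} {}"
    by (auto simp: relcomp_unfold flush_clear)
  then show ?case using Suc by (simp add: program_relcomp program_flush)
qed

lemma implementable_RComp:
  assumes f: "implementable f" and gs: "\<And>g. g \<in> set gs \<Longrightarrow> implementable g"
  shows "implementable (RComp f gs)"
  unfolding implementable_def
proof (intro allI impI)
  fix ins :: "nat list" and out t :: nat
  assume *: "\<forall>i \<in> set ins. i < t" "out < t" "out \<notin> set ins"
  let ?m = "length gs"
  obtain \<rho> where \<rho>: "program \<rho>" "\<And>\<nu> \<nu>' :: nat \<Rightarrow> nat. (\<forall>j\<ge>t. \<nu> j = 0) \<Longrightarrow> (\<nu>, \<nu>') \<in> \<rho> \<longleftrightarrow>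
    (\<exists>ys. list_all2 (\<lambda>g y. reval g (map \<nu> ins) y) gs ys \<and> \<nu>' = store \<nu> t ys)"
    using implements_list[OF gs, where ins=ins and s=t] *(1) by blast
  obtain \<sigma> where \<sigma>: "implements f [t..<t + ?m] out (t + ?m) \<sigma>"
    by (rule implementableD[OF f, of "[t..<t + ?m]" "t + ?m" out]) (use *(2) in auto)
  \<comment> \<open>The intermediate results occupy scratch registers and have to be erased to meet
    the contract of \<open>implements\<close>.\<close>
  let ?\<kappa> = "{(\<nu> :: nat \<Rightarrow> nat, \<nu>'). \<nu>' = (\<lambda>j. if t \<le> j \<and> j < t + ?m then 0 else \<nu> j)}"
  have "implements (RComp f gs) ins out t (\<rho> O \<sigma> O ?\<kappa>)"
    unfolding implements_def
  proof (intro conjI allI impI)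
    show "program (\<rho> O \<sigma> O ?\<kappa>)"
      using \<rho>(1) implementsD(1)[OF \<sigma>] program_clear_range by (intro program_relcomp)
  next
    fix \<nu> \<nu>' :: "nat \<Rightarrow> nat" assume \<nu>: "\<forall>j\<ge>t. \<nu> j = 0" "\<nu> out = 0"
    let ?G = "\<lambda>ys. list_all2 (\<lambda>g y. reval g (map \<nu> ins) y) gs ys"
    have \<sigma>_iff: "(store \<nu> t ys, \<nu>') \<in> \<sigma> O ?\<kappa> \<longleftrightarrow> (\<exists>z. reval f ys z \<and> \<nu>' = \<nu>(out := z))"
      if "?G ys" for ys
    proof -
      have len: "length ys = ?m" using that by (simp add: list_all2_lengthD)
      have "(store \<nu> t ys, \<nu>1) \<in> \<sigma> \<longleftrightarrow> (\<exists>z. reval f ys z \<and> \<nu>1 = (store \<nu> t ys)(out := z))" for \<nu>1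
        using implementsD(2)[OF \<sigma>, of "store \<nu> t ys"] \<nu> *(2) len
          store_outside[of out t ys \<nu>] store_inside[of \<nu> t ys] store_outside[of _ t ys \<nu>]
        by simp
      moreover have "(\<lambda>j. if t \<le> j \<and> j < t + ?m then 0 else ((store \<nu> t ys)(out := z)) j) = \<nu>(out := z)"
        for z
        using \<nu> *(2) len by (intro ext) (auto simp: store_outside)
      ultimately show ?thesis by (auto simp: relcomp_unfold)
    qed
    have "(\<nu>, \<nu>') \<in> \<rho> O \<sigma> O ?\<kappa> \<longleftrightarrow> (\<exists>ys. ?G ys \<and> (store \<nu> t ys, \<nu>') \<in> \<sigma> O ?\<kappa>)"
      by (rule relcomp_iff_ex[OF \<rho>(2)[OF \<nu>(1)]])
    also have "\<dots> \<longleftrightarrow> (\<exists>ys. ?G ys \<and> (\<exists>z. reval f ys z \<and> \<nu>' = \<nu>(out := z)))"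
      using \<sigma>_iff by blast
    finally show "(\<nu>, \<nu>') \<in> \<rho> O \<sigma> O ?\<kappa> \<longleftrightarrow>
        (\<exists>z. reval (RComp f gs) (map \<nu> ins) z \<and> \<nu>' = \<nu>(out := z))"
      by (auto simp: reval_RComp_iff)
  qed
  then show "\<exists>\<rho>. implements (RComp f gs) ins out t \<rho>" by blast
qed

lemma implementable_RPrim:
  assumes f: "implementable f" and g: "implementable g"
  shows "implementable (RPrim f g)"
  unfolding implementable_def
proof (intro allI impI)
  fix ins :: "nat list" and out t :: nat
  assume *: "\<forall>i \<in> set ins. i < t" "out < t" "out \<notin> set ins"
  show "\<exists>\<rho>. implements (RPrim f g) ins out t \<rho>"
  proof (cases ins)
    case Nil
    then have "implements (RPrim f g) ins out t {}"
      by (auto simp: implements_def program_basic reval_RPrim_Nil)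
    then show ?thesis by blast
  next
    case (Cons i js)
    \<comment> \<open>Register \<open>t\<close> counts the rounds, \<open>?y\<close> holds the value
      of the recursion so far, and \<open>?z\<close> receives the next value before it is moved to
      \<open>?y\<close>; scratch space begins at \<open>?T\<close>.\<close>
    let ?y = "Suc t" and ?z = "Suc (Suc t)" and ?T = "Suc (Suc (Suc t))"
    obtain \<rho> where \<rho>: "implements f js ?y ?T \<rho>"
      by (rule implementableD[OF f, of js ?T ?y]) (use * Cons in auto)
    obtain \<sigma> where \<sigma>: "implements g (?y # t # js) ?z ?T \<sigma>"
      by (rule implementableD[OF g, of "?y # t # js" ?T ?z]) (use * Cons in auto)
    \<comment> \<open>The number of iterations is guessed; the equality test in \<open>?fin\<close> rejects wrong guesses.\<close>
    let ?body = "\<sigma> O flush {?y} {} O flush {?z} {?y} O inc t"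
    let ?fin = "(flush {t, i} {?z} O flush {?z} {t, i}) O flush {?y} {out} O flush {t} {}"
    have "implements (RPrim f g) ins out t (\<rho> O ?body\<^sup>* O ?fin)"
      unfolding implements_def
    proof (intro conjI allI impI)
      show "program (\<rho> O ?body\<^sup>* O ?fin)"
        using implementsD(1)[OF \<rho>] implementsD(1)[OF \<sigma>] * Cons
        by (intro program_relcomp program_rtrancl program_flush program_basic) auto
    next
      fix \<nu> \<nu>' :: "nat \<Rightarrow> nat" assume \<nu>: "\<forall>j\<ge>t. \<nu> j = 0" "\<nu> out = 0"
      define st where "st k v = \<nu>(t := k, ?y := v)" for k v
      let ?xs = "map \<nu> js"
      have js: "map (st k v) js = ?xs" for k v using * Cons by (auto simp: st_def)
      have init: "(\<nu>, \<nu>1) \<in> \<rho> \<longleftrightarrow> (\<exists>v. reval f ?xs v \<and> \<nu>1 = st 0 v)" for \<nu>1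
      proof -
        have "\<nu>(t := 0) = \<nu>" using \<nu>(1) by auto
        then show ?thesis
          using implementsD(2)[OF \<rho>, of \<nu>] \<nu>(1) by (auto simp: st_def)
      qed
      have body: "(st k v, \<nu>1) \<in> ?body \<longleftrightarrow> (\<exists>z. reval g (v # k # ?xs) z \<and> \<nu>1 = st (Suc k) z)"
        for k v \<nu>1
      proof -
        have m: "map (st k v) (?y # t # js) = v # k # ?xs" using js by (simp add: st_def)
        have \<sigma>_iff: "(st k v, \<nu>2) \<in> \<sigma> \<longleftrightarrow> (\<exists>z. reval g (v # k # ?xs) z \<and> \<nu>2 = (st k v)(?z := z))" for \<nu>2
          using implementsD(2)[OF \<sigma>, of "st k v"] \<nu>(1) unfolding m by (simp add: st_def)
        have "((st k v)(?z := z), \<nu>1) \<in> flush {?y} {} O flush {?z} {?y} O inc t \<longleftrightarrow>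
            \<nu>1 = st (Suc k) z" for z
        proof -
          have "((st k v)(?z := z, ?y := 0, ?z := 0, ?y := z, t := Suc k)) = st (Suc k) z"
            using \<nu>(1) by (intro ext) (simp add: st_def)
          then show ?thesis
            by (simp add: relcomp_unfold flush_clear flush_move inc_def st_def)
        qed
        then show ?thesis by (simp only: relcomp_iff_ex[OF \<sigma>_iff])
      qed
      have loop1: "\<exists>k v. reval (RPrim f g) (k # ?xs) v \<and> \<nu>1 = st k v"
        if "(st 0 v0, \<nu>1) \<in> ?body\<^sup>*" "reval f ?xs v0" for v0 \<nu>1
        using that
      proof (induction rule: rtrancl_induct)
        case base
        then show ?case using reval_RPrim_0_iff by blast
      next
        case (step \<nu>2 \<nu>3)
        then obtain k v where kv: "reval (RPrim f g) (k # ?xs) v" "\<nu>2 = st k v" by blast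
        with step(2) body obtain z where "reval g (v # k # ?xs) z" "\<nu>3 = st (Suc k) z" by blast
        with kv(1) show ?case using reval_RPrim_Suc_iff by blast
      qed
      have loop2: "\<exists>v0. reval f ?xs v0 \<and> (st 0 v0, st k v) \<in> ?body\<^sup>*"
        if "reval (RPrim f g) (k # ?xs) v" for k v
        using that
      proof (induction k arbitrary: v)
        case 0
        then show ?case using reval_RPrim_0_iff by blast
      next
        case (Suc k)
        then obtain y where y: "reval (RPrim f g) (k # ?xs) y" "reval g (y # k # ?xs) v"
          using reval_RPrim_Suc_iff by blast
        from Suc.IH[OF y(1)] obtain v0 where "reval f ?xs v0" "(st 0 v0, st k y) \<in> ?body\<^sup>*" by blast
        moreover have "(st k y, st (Suc k) v) \<in> ?body" using body y(2) by blast
        ultimately show ?case by (meson rtrancl_into_rtrancl)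
      qed
      have fin: "(st k v, \<nu>1) \<in> ?fin \<longleftrightarrow> k = \<nu> i \<and> \<nu>1 = \<nu>(out := v)" for k v \<nu>1
      proof -
        have i: "i < t" using * Cons by simp
        have "(st k v, \<nu>2) \<in> flush {t, i} {?z} O flush {?z} {t, i} \<longleftrightarrow> k = \<nu> i \<and> \<nu>2 = st k v" for \<nu>2
          using i \<nu>(1) by (subst equality_test) (auto simp: st_def)
        moreover have "(st k v, \<nu>1) \<in> flush {?y} {out} O flush {t} {} \<longleftrightarrow> \<nu>1 = \<nu>(out := v)"
        proof -
          have "(st k v)(?y := 0, out := v, t := 0) = \<nu>(out := v)"
            using \<nu> *(2) by (intro ext) (simp add: st_def)
          then show ?thesis
            using *(2) \<nu>(2) by (simp add: relcomp_unfold flush_clear flush_move st_def)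
        qed
        ultimately show ?thesis
          unfolding relcomp_iff[of _ _ "flush {t, i} {?z} O flush {?z} {t, i}"] by simp
      qed
      \<comment> \<open>Counter and value are packed into one pair \<open>p\<close>, since
        \<open>relcomp_iff_ex\<close> expects a single parameter.\<close>
      have loop: "(\<nu>, \<nu>1) \<in> \<rho> O ?body\<^sup>* \<longleftrightarrow>
          (\<exists>p. reval (RPrim f g) (fst p # ?xs) (snd p) \<and> \<nu>1 = st (fst p) (snd p))" for \<nu>1
        unfolding relcomp_iff_ex[OF init] split_paired_Ex fst_conv snd_conv
        using loop1 loop2 by blast
      have "(\<nu>, \<nu>') \<in> \<rho> O ?body\<^sup>* O ?fin \<longleftrightarrow>
          (\<exists>p. reval (RPrim f g) (fst p # ?xs) (snd p) \<and> (st (fst p) (snd p), \<nu>') \<in> ?fin)"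
        by (rule relcomp_iff_ex[OF loop, unfolded O_assoc])
      then show "(\<nu>, \<nu>') \<in> \<rho> O ?body\<^sup>* O ?fin \<longleftrightarrow>
          (\<exists>z. reval (RPrim f g) (map \<nu> ins) z \<and> \<nu>' = \<nu>(out := z))"
        unfolding fin using Cons by auto
    qed
    then show ?thesis by blast
  qed
qed

lemma implementable_RMin:
  assumes f: "implementable f"
  shows "implementable (RMin f)"
  unfolding implementable_def
proof (intro allI impI)
  fix ins :: "nat list" and out t :: nat
  assume *: "\<forall>i \<in> set ins. i < t" "out < t" "out \<notin> set ins"
  let ?y = "Suc t" and ?T = "Suc (Suc t)"
  obtain \<rho> where \<rho>: "implements f (t # ins) ?y ?T \<rho>"
    by (rule implementableD[OF f, of "t # ins" ?T ?y]) (use * in auto)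
  \<comment> \<open>Register \<open>t\<close> holds the current candidate. The decrement of
    \<open>?y\<close> blocks at 0, so another round requires a nonzero value, the rest of which is
    then cleared; \<open>?fin\<close> evaluates \<open>f\<close> at the final candidate and demands
    0.\<close>
  let ?body = "\<rho> O (inc ?y)\<inverse> O flush {?y} {} O inc t"
  let ?fin = "\<rho> O zero_test ?y O flush {t} {out}"
  have "implements (RMin f) ins out t (?body\<^sup>* O ?fin)"
    unfolding implements_def
  proof (intro conjI allI impI)
    show "program (?body\<^sup>* O ?fin)"
      using implementsD(1)[OF \<rho>] *
      by (intro program_relcomp program_rtrancl program_flush program_basic) auto
  next
    fix \<nu> \<nu>' :: "nat \<Rightarrow> nat" assume \<nu>: "\<forall>j\<ge>t. \<nu> j = 0" "\<nu> out = 0"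
    define st where "st k = \<nu>(t := k)" for k
    let ?xs = "map \<nu> ins"
    have ins: "map (st k) (t # ins) = k # ?xs" for k using * by (auto simp: st_def)
    have \<rho>_iff: "(st k, \<nu>1) \<in> \<rho> \<longleftrightarrow> (\<exists>v. reval f (k # ?xs) v \<and> \<nu>1 = (st k)(?y := v))" for k \<nu>1
      using implementsD(2)[OF \<rho>, of "st k"] \<nu>(1) unfolding ins by (simp add: st_def)
    have body: "(st k, \<nu>1) \<in> ?body \<longleftrightarrow> (\<exists>v. v \<noteq> 0 \<and> reval f (k # ?xs) v) \<and> \<nu>1 = st (Suc k)" for k \<nu>1
    proof -
      have "((st k)(?y := v), \<nu>1) \<in> (inc ?y)\<inverse> O flush {?y} {} O inc t \<longleftrightarrow>
          v \<noteq> 0 \<and> \<nu>1 = st (Suc k)" for v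
      proof -
        have dec: "((st k)(?y := v), \<nu>2) \<in> (inc ?y)\<inverse> \<longleftrightarrow>
            (\<exists>u. v = Suc u \<and> \<nu>2 = (st k)(?y := u))" for \<nu>2
        proof
          assume "((st k)(?y := v), \<nu>2) \<in> (inc ?y)\<inverse>"
          then have eq: "(st k)(?y := v) = \<nu>2(?y := Suc (\<nu>2 ?y))" by (auto simp: inc_def)
          then have "\<nu>2 = (st k)(?y := \<nu>2 ?y)" by (metis fun_upd_triv fun_upd_upd)
          moreover from eq have "v = Suc (\<nu>2 ?y)" by (metis fun_upd_same)
          ultimately show "\<exists>u. v = Suc u \<and> \<nu>2 = (st k)(?y := u)" by blast
        qed (auto simp: inc_def)
        have "(st k)(?y := 0, t := Suc k) = st (Suc k)"
          using \<nu>(1) by (intro ext) (simp add: st_def)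
        then have "((st k)(?y := u), \<nu>1) \<in> flush {?y} {} O inc t \<longleftrightarrow> \<nu>1 = st (Suc k)" for u
          by (simp add: relcomp_unfold flush_clear inc_def st_def)
        then show ?thesis
          by (simp only: relcomp_iff_ex[OF dec]) (cases v, auto)
      qed
      then show ?thesis by (simp only: relcomp_iff_ex[OF \<rho>_iff]) blast
    qed
    have loop: "(st 0, \<nu>1) \<in> ?body\<^sup>* \<longleftrightarrow>
        (\<exists>n. (\<forall>k<n. \<exists>v. v \<noteq> 0 \<and> reval f (k # ?xs) v) \<and> \<nu>1 = st n)" for \<nu>1
    proof
      assume "(st 0, \<nu>1) \<in> ?body\<^sup>*"
      then show "\<exists>n. (\<forall>k<n. \<exists>v. v \<noteq> 0 \<and> reval f (k # ?xs) v) \<and> \<nu>1 = st n"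
      proof (induction rule: rtrancl_induct)
        case base
        show ?case by (rule exI[of _ 0]) simp
      next
        case (step \<nu>2 \<nu>3)
        then obtain n where n: "\<forall>k<n. \<exists>v. v \<noteq> 0 \<and> reval f (k # ?xs) v" "\<nu>2 = st n" by blast
        with step(2) body have "\<exists>v. v \<noteq> 0 \<and> reval f (n # ?xs) v" "\<nu>3 = st (Suc n)" by blast+
        with n(1) show ?case by (intro exI[of _ "Suc n"]) (auto simp: less_Suc_eq)
      qed
    next
      assume "\<exists>n. (\<forall>k<n. \<exists>v. v \<noteq> 0 \<and> reval f (k # ?xs) v) \<and> \<nu>1 = st n"
      then obtain n where "\<forall>k<n. \<exists>v. v \<noteq> 0 \<and> reval f (k # ?xs) v" "\<nu>1 = st n" by blast
      then show "(st 0, \<nu>1) \<in> ?body\<^sup>*"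
      proof (induction n arbitrary: \<nu>1)
        case (Suc n)
        have "(st 0, st n) \<in> ?body\<^sup>*"
          using Suc.prems(1) by (intro Suc.IH[OF _ refl]) simp
        moreover have "(st n, st (Suc n)) \<in> ?body" unfolding body using Suc.prems(1) by simp
        ultimately show ?case unfolding Suc.prems(2) by (rule rtrancl_into_rtrancl)
      qed simp
    qed
    have fin: "(st n, \<nu>1) \<in> ?fin \<longleftrightarrow> reval f (n # ?xs) 0 \<and> \<nu>1 = \<nu>(out := n)" for n \<nu>1
    proof -
      have "((st n)(?y := v), \<nu>1) \<in> zero_test ?y O flush {t} {out} \<longleftrightarrow> v = 0 \<and> \<nu>1 = \<nu>(out := n)" for v
      proof -
        have "((st n)(?y := 0))(t := 0, out := n) = \<nu>(out := n)"
          using \<nu> *(2) by (intro ext) (simp add: st_def)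
        then show ?thesis
          using *(2) \<nu>(2) by (auto simp: relcomp_unfold zero_test_def flush_move st_def)
      qed
      then show ?thesis by (simp only: relcomp_iff_ex[OF \<rho>_iff]) blast
    qed
    have "st 0 = \<nu>" using \<nu>(1) by (auto simp: st_def)
    then have "(\<nu>, \<nu>') \<in> ?body\<^sup>* O ?fin \<longleftrightarrow>
        (\<exists>n. (\<forall>k<n. \<exists>v. v \<noteq> 0 \<and> reval f (k # ?xs) v) \<and> (st n, \<nu>') \<in> ?fin)"
      using relcomp_iff_ex[OF loop] by simp
    then show "(\<nu>, \<nu>') \<in> ?body\<^sup>* O ?fin \<longleftrightarrow>
        (\<exists>z. reval (RMin f) (map \<nu> ins) z \<and> \<nu>' = \<nu>(out := z))"
      unfolding fin by (auto simp: reval_RMin_iff)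
  qed
  then show "\<exists>\<rho>. implements (RMin f) ins out t \<rho>" by blast
qed

theorem implementable_recf: "implementable f"
  by (induction f) (simp_all add: implementable_RZero implementable_RSucc implementable_RProj
      implementable_RComp implementable_RPrim implementable_RMin)

section \<open>Halting as a property of a regular queue language\<close>

definition drain_lang :: "(bool \<times> bool) list set" where
  "drain_lang = star (star {[(False, False)]} \<cdot> {[(False, True)]})"

lemma regular_drain_lang: "regular drain_lang"
  unfolding drain_lang_def by (intro regular_star regular_conc regular_single)

lemma drain_lang_complete: "map (Pair False) (blocks xs) \<in> drain_lang"
proof -
  have "map (Pair False) (replicate x False) \<in> star {[(False, False)]}" for x
    by (induction x) (auto intro: star_Nil star_app[of "[_]", simplified])
  then have "map (Pair False) (block x) \<in> star {[(False, False)]} \<cdot> {[(False, True)]}" for x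
    unfolding block_def by (simp add: concI)
  then show ?thesis
    unfolding drain_lang_def by (induction xs) (auto intro: star_Nil star_app)
qed

lemma drain_lang_sound:
  assumes "w \<in> drain_lang"
  shows "written w = [] \<and> (\<exists>xs. consumed w = blocks xs)"
proof -
  have 1: "written u = [] \<and> (\<exists>x. consumed u = replicate x False)"
    if "u \<in> star {[(False, False)]}" for u
    using that by (induction rule: star.induct) (auto, metis replicate_Suc)
  have 2: "written u = [] \<and> (\<exists>x. consumed u = block x)"
    if "u \<in> star {[(False, False)]} \<cdot> {[(False, True)]}" for u
    using that 1 by (fastforce elim!: concE simp: block_def)
  show ?thesis
    using assms unfolding drain_lang_def
  proof (induction rule: star.induct)
    case star_Nil
    show ?case by (auto intro: exI[of _ "[]"])
  next
    case (star_app u v)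
    then obtain x xs where "consumed u = block x" "consumed v = blocks xs" using 2 by blast
    then show ?case
      using 2[OF star_app(1)] star_app(3) by (intro conjI exI[of _ "x # xs"]) auto
  qed
qed

text \<open>The language does not depend on the input. Initially the queue holds only
  \<open>e\<close> letters \<open>False\<close>, an unfinished block of register 0, which can be
  produced without knowing the number of registers.\<close>

theorem halting_as_queue_language:
  obtains L :: "(bool \<times> bool) list set" where "regular L" "[] \<notin> L"
    "\<And>e z. reval f [e] z \<Longrightarrow> \<exists>w \<in> L. qrun (replicate e False) w []"
    "\<And>e w. w \<in> L \<Longrightarrow> replicate e False @ written w = consumed w \<Longrightarrow> \<exists>z. reval f [e] z"
proof -
  obtain \<rho> where \<rho>: "implements f [0] 1 2 \<rho>"
    by (rule implementableD[OF implementable_recf, of "[0]" 2 1 f]) auto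
  from implementsD(1)[OF \<rho>] obtain r0 where "counter_prog r0 \<rho>" by (auto simp: program_def)
  \<comment> \<open>One more register ensures that register 0 exists.\<close>
  then have "counter_prog (Suc r0) \<rho>" by (rule counter_prog_mono) simp
  then obtain A where A: "queue_impl (Suc r0) \<rho> A" using counter_prog_queue_impl by blast
  \<comment> \<open>The first \<open>True\<close> ends the block of register 0; each of the other
    \<open>r0\<close> letters is the block of a register that holds 0.\<close>
  define start where "start = map (Pair True) (True # replicate r0 True)"
  \<comment> \<open>Stability demands empty channels, so \<open>drain_lang\<close> removes the final
    register contents, whatever they are.\<close>
  define L where "L = {start} \<cdot> A \<cdot> drain_lang"
  define \<nu> where "\<nu> e j = (if j = 0 then e else 0)" for e j :: nat
  have \<rho>_iff: "(\<nu> e, \<nu>') \<in> \<rho> \<longleftrightarrow> (\<exists>z. reval f [e] z \<and> \<nu>' = (\<nu> e)(1 := z))" for e \<nu>'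
    using implementsD(2)[OF \<rho>, of "\<nu> e"] by (simp add: \<nu>_def)
  have "blocks (replicate k 0) = replicate k True" for k
    by (induction k) (auto simp: block_def)
  then have \<nu>: "map (\<nu> e) [0..<Suc r0] = e # replicate r0 0"
    "blocks (e # replicate r0 0) = replicate e False @ True # replicate r0 True" for e
    by (auto intro!: nth_equalityI simp: \<nu>_def nth_Cons' block_def simp del: upt_Suc)
  show ?thesis
  proof
    show "regular L"
      using A unfolding L_def queue_impl_def
      by (auto intro!: regular_conc regular_singleton regular_drain_lang)
    show "[] \<notin> L" by (auto simp: L_def start_def conc_def)
  next
    fix e z assume "reval f [e] z"
    then have "(\<nu> e, (\<nu> e)(1 := z)) \<in> \<rho>"
      unfolding \<rho>_iff by blast
    then obtain w xs where w: "w \<in> A" "qrun (blocks (map (\<nu> e) [0..<Suc r0])) w (blocks xs)"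
      using A unfolding queue_impl_def by blast
    have "qrun (replicate e False) start (blocks (map (\<nu> e) [0..<Suc r0]))"
      using qrun_write_all[of "replicate e False" "True # replicate r0 True"]
      by (simp only: \<nu> start_def)
    then have "qrun (replicate e False) (start @ w @ map (Pair False) (blocks xs)) []"
      using w(2) qrun_consume_all by (blast intro: qrun_append)
    moreover have "start @ w @ map (Pair False) (blocks xs) \<in> L"
      using w(1) drain_lang_complete unfolding L_def by (intro concI) auto
    ultimately show "\<exists>w \<in> L. qrun (replicate e False) w []" by blast
  next
    fix e w assume "w \<in> L" and eq: "replicate e False @ written w = consumed w"
    then obtain a d where w: "w = start @ a @ d" "a \<in> A" "d \<in> drain_lang"
      by (auto simp: L_def elim!: concE)
    from A w(2) obtain us vs where a: "length us = length vs" "consumed a = blocks us"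
      "written a = blocks vs" "\<And>\<nu> \<nu>'. map \<nu> [0..<Suc r0] @ vs = us @ map \<nu>' [0..<Suc r0] \<Longrightarrow>
         (\<forall>j\<ge>Suc r0. \<nu>' j = \<nu> j) \<Longrightarrow> (\<nu>, \<nu>') \<in> \<rho>"
      unfolding queue_impl_def transforms_def by blast
    have start: "written start = True # replicate r0 True" "consumed start = []"
      by (auto simp: start_def written_def consumed_def filter_map comp_def)
    \<comment> \<open>What \<open>start\<close> writes completes the input to the initial register
      contents, and the drain writes nothing. Equality of the projections thus becomes an equation
      that can be parsed into blocks.\<close>
    have "blocks (e # replicate r0 0) @ blocks vs = blocks us @ consumed d"
      unfolding \<nu>(2) using eq w(1) a(2,3) start drain_lang_sound[OF w(3)] by simp
    then have "blocks ((e # replicate r0 0) @ vs) = blocks us @ consumed d"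
      by (simp only: blocks_simps(3))
    then obtain ys where ys: "(e # replicate r0 0) @ vs = us @ ys"
      using blocks_eq_append by blast
    have len: "length ys = Suc r0" using arg_cong[OF ys, of length] a(1) by simp
    define \<nu>' where "\<nu>' j = (if j < Suc r0 then ys ! j else 0)" for j
    have \<nu>': "map \<nu>' [0..<Suc r0] = ys"
      using len by (auto intro!: nth_equalityI simp: \<nu>'_def simp del: upt_Suc)
    have "(\<nu> e, \<nu>') \<in> \<rho>"
    proof (rule a(4))
      show "map (\<nu> e) [0..<Suc r0] @ vs = us @ map \<nu>' [0..<Suc r0]"
        unfolding \<nu>(1) \<nu>' by (rule ys)
      show "\<forall>j\<ge>Suc r0. \<nu>' j = \<nu> e j" by (simp add: \<nu>_def \<nu>'_def)
    qed
    then show "\<exists>z. reval f [e] z"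
      unfolding \<rho>_iff by blast
  qed
qed

section \<open>Protocols on a cycle\<close>

definition labelled :: "trans set \<Rightarrow> (nat \<times> (bool \<times> nat) \<times> nat) set" where
  "labelled T = {(p, (s, b), q) |p s b q. (p, s, b, q) \<in> T}"

definition actions :: "bool \<Rightarrow> nat set \<Rightarrow> (bool \<times> nat) list \<Rightarrow> nat list" where
  "actions s M u = map snd (filter (\<lambda>(s', b). s' = s \<and> b \<in> M) u)"

lemma actions_simps [simp]:
  "actions s M [] = []"
  "actions s M ((s', b) # u) = (if s' = s \<and> b \<in> M then b # actions s M u else actions s M u)"
  "actions s M (u @ v) = actions s M u @ actions s M v"
  by (auto simp: actions_def)

text \<open>Channels are first-in first-out, so sending and receiving both preserve the equation.
  Only the history of each single machine is kept, not the interleaving; disjointness of the message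
  sets keeps the words on different edges apart.\<close>

lemma reachable_histories:
  assumes disj: "\<And>\<xi> \<xi>'. \<xi> \<noteq> \<xi>' \<Longrightarrow> msg_of P \<xi> \<inter> msg_of P \<xi>' = {}"
    and "(step n es P)\<^sup>*\<^sup>* (initial_global n es P) (S, C)"
  shows "\<exists>u. (\<forall>j<n. path (labelled (transitions P j)) (initial P j) (u j) (S ! j)) \<and>
    (\<forall>\<xi><length es. actions True (msg_of P \<xi>) (u (fst (es ! \<xi>))) =
       actions False (msg_of P \<xi>) (u (snd (es ! \<xi>))) @ C ! \<xi>)"
proof -
  have "length S = n \<and> length C = length es \<and>
    (\<exists>u. (\<forall>j<n. path (labelled (transitions P j)) (initial P j) (u j) (S ! j)) \<and>
    (\<forall>\<xi><length es. actions True (msg_of P \<xi>) (u (fst (es ! \<xi>))) =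
       actions False (msg_of P \<xi>) (u (snd (es ! \<xi>))) @ C ! \<xi>))"
    using assms(2)
  proof (induction "(S, C)" arbitrary: S C rule: rtranclp_induct)
    case base
    then show ?case
      by (auto simp: initial_global_def intro!: exI[of _ "\<lambda>_. []"] path_Nil)
  next
    case (step g)
    obtain S0 C0 where g: "g = (S0, C0)" by (cases g)
    from step(3)[OF g] obtain u where len: "length S0 = n" "length C0 = length es"
      and u: "\<And>j. j < n \<Longrightarrow> path (labelled (transitions P j)) (initial P j) (u j) (S0 ! j)"
      and ch: "\<And>\<xi>. \<xi> < length es \<Longrightarrow> actions True (msg_of P \<xi>) (u (fst (es ! \<xi>))) =
         actions False (msg_of P \<xi>) (u (snd (es ! \<xi>))) @ C0 ! \<xi>"
      by auto
    from step(2)[unfolded g] show ?case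
    proof cases
      case (step_send i \<xi> b q)
      let ?u = "u(i := u i @ [(True, b)])"
      have "path (labelled (transitions P j)) (initial P j) (?u j) (S ! j)" if "j < n" for j
        using step_send u[OF that] len that
        by (auto simp: labelled_def nth_list_update intro!: path_snoc)
      moreover have "actions True (msg_of P \<xi>') (?u (fst (es ! \<xi>'))) =
         actions False (msg_of P \<xi>') (?u (snd (es ! \<xi>'))) @ C ! \<xi>'" if "\<xi>' < length es" for \<xi>'
        using step_send ch[OF that] len that disj[of \<xi> \<xi>']
        by (cases "\<xi>' = \<xi>") auto
      moreover have "length S = n" "length C = length es" using step_send len by simp_all
      ultimately show ?thesis by blast
    next
      case (step_recv i \<xi> b q w)
      let ?u = "u(i := u i @ [(False, b)])"
      have "path (labelled (transitions P j)) (initial P j) (?u j) (S ! j)" if "j < n" for j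
        using step_recv u[OF that] len that
        by (auto simp: labelled_def nth_list_update intro!: path_snoc)
      moreover have "actions True (msg_of P \<xi>') (?u (fst (es ! \<xi>'))) =
         actions False (msg_of P \<xi>') (?u (snd (es ! \<xi>'))) @ C ! \<xi>'" if "\<xi>' < length es" for \<xi>'
        using step_recv ch[OF that] len that disj[of \<xi> \<xi>']
        by (cases "\<xi>' = \<xi>") auto
      moreover have "length S = n" "length C = length es" using step_recv len by simp_all
      ultimately show ?thesis by blast
    qed
  qed
  then show ?thesis by blast
qed

section \<open>Binary messages and the protocol on an oriented cycle\<close>

definition msg :: "nat \<Rightarrow> bool \<Rightarrow> nat" where
  "msg \<xi> b = 2 * \<xi> + (if b then 1 else 0)"

lemma inj_msg: "inj (msg \<xi>)"
  by (auto simp: inj_def msg_def split: if_splits)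

lemma msg_div: "msg \<xi> b div 2 = \<xi>"
  by (auto simp: msg_def)

locale oriented_cycle =
  fixes n :: nat and es :: "(nat \<times> nat) list" and cs vs :: "nat list"
  assumes graph: "graph_ok n es" and cycle: "undirected_cycle es cs vs"
    and orient: "es ! (cs ! 0) = (vs ! 0, vs ! 1) \<or>
      es ! (cs ! (length cs - 1)) = (vs ! (length cs - 1), vs ! length cs)"
begin

abbreviation m :: nat where "m \<equiv> length cs"

definition fwd :: "nat \<Rightarrow> bool" where
  "fwd k \<longleftrightarrow> es ! (cs ! k) = (vs ! k, vs ! Suc k)"

lemma m_pos: "0 < m"
  using cycle by (auto simp: undirected_cycle_def)

lemma orient_fwd: "fwd 0 \<or> fwd (m - 1)"
  using orient m_pos by (auto simp: fwd_def)

lemma edge_less: "k < m \<Longrightarrow> cs ! k < length es"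
  using cycle by (auto simp: undirected_cycle_def)

lemma edge_eq_iff: "i < m \<Longrightarrow> j < m \<Longrightarrow> cs ! i = cs ! j \<longleftrightarrow> i = j"
  using cycle by (auto simp: undirected_cycle_def nth_eq_iff_index_eq)

lemma edge_endpoints:
  "k < m \<Longrightarrow> es ! (cs ! k) = (if fwd k then (vs ! k, vs ! Suc k) else (vs ! Suc k, vs ! k))"
  using cycle by (auto simp: undirected_cycle_def fwd_def)

lemma closed: "vs ! m = vs ! 0"
  using cycle by (auto simp: undirected_cycle_def)

lemma node_less: "k \<le> m \<Longrightarrow> vs ! k < n"
proof -
  have *: "vs ! k < n" if "k < m" for k
  proof -
    have "es ! (cs ! k) \<in> set es" using edge_less[OF that] by simp
    then show ?thesis
      using graph edge_endpoints[OF that] by (auto simp: graph_ok_def split: if_splits)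
  qed
  assume "k \<le> m"
  then show ?thesis using *[of k] *[of 0] closed m_pos by (cases "k = m") auto
qed

lemma node_eq_iff: "i < m \<Longrightarrow> j < m \<Longrightarrow> vs ! i = vs ! j \<longleftrightarrow> i = j"
proof -
  assume "i < m" "j < m"
  moreover have "length (butlast vs) = m" "distinct (butlast vs)"
    using cycle by (auto simp: undirected_cycle_def)
  ultimately show ?thesis
    using nth_eq_iff_index_eq[of "butlast vs" i j] by (simp add: nth_butlast)
qed

text \<open>The actions, as pairs (send?, message), of the nodes \<open>vs ! k\<close> and \<open>vs ! Suc k\<close> on the edge
  \<open>k\<close> of the cycle that joins them.\<close>

definition lop :: "nat \<Rightarrow> bool \<Rightarrow> bool \<times> nat" where
  "lop k b = (fwd k, msg (cs ! k) b)"

definition rop :: "nat \<Rightarrow> bool \<Rightarrow> bool \<times> nat" where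
  "rop k b = (\<not> fwd k, msg (cs ! k) b)"

text \<open>The action on edge \<open>k - 1\<close> comes first unless it is a send, so that no letter is sent before it is received.\<close>

definition first_op :: "nat \<Rightarrow> bool \<Rightarrow> bool \<times> nat" where
  "first_op k b = (if fwd (k - 1) then rop (k - 1) b else lop k b)"

definition second_op :: "nat \<Rightarrow> bool \<Rightarrow> bool \<times> nat" where
  "second_op k b = (if fwd (k - 1) then lop k b else rop (k - 1) b)"

definition hold :: "bool \<Rightarrow> nat" where
  "hold b = (if b then 2 else 1)"

lemma hold_neq_0: "hold b \<noteq> 0"
  by (simp add: hold_def)

lemma hold_inject: "hold b = hold b' \<longleftrightarrow> b = b'"
  by (auto simp: hold_def)

definition trans_of :: "nat \<times> (bool \<times> nat) \<times> nat \<Rightarrow> trans" where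
  "trans_of t = (case t of (p, (s, b), q) \<Rightarrow> (p, s, b, q))"

definition copy_trans :: "nat \<Rightarrow> trans list" where
  "copy_trans k = concat (map (\<lambda>b. [trans_of (0, first_op k b, hold b),
     trans_of (hold b, second_op k b, 0)]) [False, True])"

text \<open>For a node off the cycle the filter leaves no index, and the machine never moves. Index
  0 is left out because the base node runs the automaton.\<close>

definition side_machine :: "nat \<Rightarrow> fsm" where
  "side_machine j = ([0, 1, 2], 0, concat (map copy_trans (filter (\<lambda>k. vs ! k = j) [1..<m])))"

definition lab :: "bool \<times> bool \<Rightarrow> bool \<times> nat" where
  "lab a = (if fst a then lop 0 (snd a) else rop (m - 1) (snd a))"

definition relabel :: "nat \<times> (bool \<times> bool) \<times> nat \<Rightarrow> trans" where
  "relabel t = (case t of (p, a, q) \<Rightarrow> trans_of (p, lab a, q))"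

definition msgs :: "(nat \<times> nat) list" where
  "msgs = concat (map (\<lambda>\<xi>. [(2 * \<xi>, \<xi>), (2 * \<xi> + 1, \<xi>)]) [0..<length es])"

definition prot :: "fsm \<Rightarrow> protocol" where
  "prot M = (msgs, map (\<lambda>j. if j = vs ! 0 then M else side_machine j) [0..<n])"

lemma msg_of_prot: "msg_of (prot M) \<xi> = (if \<xi> < length es then {b. b div 2 = \<xi>} else {})"
proof -
  have "b = 2 * (b div 2) \<or> b = Suc (2 * (b div 2))" for b :: nat by presburger
  then show ?thesis by (auto simp: msg_of_def prot_def msgs_def intro!: bexI[of _ \<xi>])
qed

lemma msg_in_msg_of: "\<xi> < length es \<Longrightarrow> msg \<xi> b \<in> msg_of (prot M) \<xi>' \<longleftrightarrow> \<xi>' = \<xi>"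
  by (auto simp: msg_of_prot msg_div)

lemma machine_prot: "j < n \<Longrightarrow> machine (prot M) j = (if j = vs ! 0 then M else side_machine j)"
  by (simp add: machine_def prot_def)

lemma labelled_trans_of: "labelled (trans_of ` A) = A"
proof -
  have inj: "inj trans_of" by (auto simp: inj_def trans_of_def)
  have "(p, s, b, q) \<in> trans_of ` A \<longleftrightarrow> (p, (s, b), q) \<in> A" for p s b q
    using inj_image_mem_iff[OF inj, of "(p, (s, b), q)" A] by (simp add: trans_of_def)
  then show ?thesis by (auto simp: labelled_def)
qed

lemma transitions_main: "transitions (prot (Ks, h, Ts)) (vs ! 0) = set Ts"
  using node_less[of 0] by (simp add: transitions_def machine_prot)

lemma transitions_copy:
  assumes "0 < k" "k < m"
  shows "transitions (prot M) (vs ! k) = trans_of `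
    (\<Union>b. {(0, first_op k b, hold b), (hold b, second_op k b, 0)})"
proof -
  have "set (filter (\<lambda>k'. vs ! k' = vs ! k) [1..<m]) = {k}"
    using assms by (auto simp: node_eq_iff)
  moreover have "vs ! k \<noteq> vs ! 0" using assms m_pos node_eq_iff[of k 0] by simp
  ultimately show ?thesis
    using assms node_less[of k]
    by (auto simp: transitions_def machine_prot side_machine_def copy_trans_def UNIV_bool)
qed

text \<open>A path that ends in 0 consists of completed pairs of actions. The second conjunct
  carries the induction through the states that hold a letter.\<close>

lemma copy_word:
  assumes "path (\<Union>b. {(0, first_op k b, hold b), (hold b, second_op k b, 0)}) p u 0"
  shows "(p = 0 \<longrightarrow> (\<exists>x. u = concat (map (\<lambda>b. [first_op k b, second_op k b]) x))) \<and>
    (\<forall>b. p = hold b \<longrightarrow>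
      (\<exists>x. u = second_op k b # concat (map (\<lambda>b. [first_op k b, second_op k b]) x)))"
  using assms
proof (induction p u "0::nat" rule: path.induct)
  case path_Nil
  show ?case by (auto simp: hold_def intro: exI[of _ "[]"] split: if_splits)
next
  case (path_Cons p a q u)
  from path_Cons(1) consider b where "p = 0" "a = first_op k b" "q = hold b"
    | b where "p = hold b" "a = second_op k b" "q = 0" by blast
  then show ?case
  proof cases
    case 1
    with path_Cons(3) obtain x where
      "u = second_op k b # concat (map (\<lambda>b. [first_op k b, second_op k b]) x)" by blast
    then have "a # u = concat (map (\<lambda>b. [first_op k b, second_op k b]) (b # x))" using 1 by simp
    then show ?thesis using 1(1) hold_neq_0 by blast
  next
    case 2
    with path_Cons(3) obtain x where "u = concat (map (\<lambda>b. [first_op k b, second_op k b]) x)" by blast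
    then show ?thesis using 2 by (auto simp: hold_neq_0 hold_inject)
  qed
qed

text \<open>With all channels empty at the end, both ends of an edge have handled the same word on
  it, and a copying node back in state 0 has handled the same word on its two edges. Going around
  the cycle, the word written on edge 0 arrives at edge \<open>m - 1\<close> as the word consumed.
  The argument ignores time and orientation.\<close>

lemma stable_sound:
  assumes Ts: "set Ts = relabel ` T"
    and stable: "stable_cs n es (prot (Ks, h, Ts)) (replicate n 0)"
  shows "\<exists>W. path T h W 0 \<and> written W = consumed W"
proof -
  let ?P = "prot (Ks, h, Ts)"
  let ?act = "\<lambda>s \<xi>. actions s (msg_of ?P \<xi>)"
  have disj: "msg_of ?P \<xi> \<inter> msg_of ?P \<xi>' = {}" if "\<xi> \<noteq> \<xi>'" for \<xi> \<xi>'
    using that by (auto simp: msg_of_prot)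
  obtain u where u: "\<And>j. j < n \<Longrightarrow>
      path (labelled (transitions ?P j)) (initial ?P j) (u j) (replicate n 0 ! j)"
    and ch: "\<And>\<xi>. \<xi> < length es \<Longrightarrow> ?act True \<xi> (u (fst (es ! \<xi>))) =
       ?act False \<xi> (u (snd (es ! \<xi>))) @ replicate (length es) [] ! \<xi>"
    using reachable_histories[OF disj stable[unfolded stable_cs_def]] by blast
  have edge: "?act (fwd k) (cs ! k) (u (vs ! k)) = ?act (\<not> fwd k) (cs ! k) (u (vs ! Suc k))"
    if "k < m" for k
    using ch[OF edge_less[OF that]] edge_endpoints[OF that] edge_less[OF that]
    by (cases "fwd k") auto
  have lop: "?act s (cs ! i) (lop k b # v) =
      (if i = k \<and> s = fwd k then msg (cs ! k) b # ?act s (cs ! i) v else ?act s (cs ! i) v)"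
    "?act s (cs ! i) (rop k b # v) =
      (if i = k \<and> s = (\<not> fwd k) then msg (cs ! k) b # ?act s (cs ! i) v else ?act s (cs ! i) v)"
    if "i < m" "k < m" for s i k b v
    using that by (auto simp: lop_def rop_def msg_in_msg_of edge_less edge_eq_iff)
  have copy: "?act (\<not> fwd (k - 1)) (cs ! (k - 1)) (u (vs ! k)) = map (msg (cs ! (k - 1))) x \<Longrightarrow>
      ?act (fwd k) (cs ! k) (u (vs ! k)) = map (msg (cs ! k)) x" if "0 < k" "k < m" for k x
  proof -
    have "vs ! k \<noteq> vs ! 0" using that m_pos node_eq_iff[of k 0] by simp
    then have "initial ?P (vs ! k) = 0"
      using node_less[of k] that by (simp add: initial_def machine_prot side_machine_def)
    moreover have "vs ! k < n" using node_less[of k] that by simp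
    ultimately have "path (\<Union>b. {(0, first_op k b, hold b), (hold b, second_op k b, 0)}) 0 (u (vs ! k)) 0"
      using u[of "vs ! k"] unfolding transitions_copy[OF that] labelled_trans_of by simp
    from copy_word[OF this]
    obtain y where y: "u (vs ! k) = concat (map (\<lambda>b. [first_op k b, second_op k b]) y)" by blast
    have "?act (\<not> fwd (k - 1)) (cs ! (k - 1)) (u (vs ! k)) = map (msg (cs ! (k - 1))) y"
      "?act (fwd k) (cs ! k) (u (vs ! k)) = map (msg (cs ! k)) y"
      unfolding y using that
      by (induction y) (auto simp: lop first_op_def second_op_def simp del: actions_simps(2))
    moreover assume "?act (\<not> fwd (k - 1)) (cs ! (k - 1)) (u (vs ! k)) = map (msg (cs ! (k - 1))) x"
    ultimately show ?thesis using inj_map_eq_map[OF inj_msg] by metis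
  qed
  have main: "\<exists>W. path T p W q \<and> v = map lab W"
    if "path (labelled (relabel ` T)) p v q" for p v q
    using that
  proof (induction rule: path.induct)
    case (path_Cons p a q v r)
    then obtain W where "path T q W r" "v = map lab W" by blast
    moreover from path_Cons(1) obtain a' where "(p, a', q) \<in> T" "a = lab a'"
      by (auto simp: labelled_def relabel_def trans_of_def split: prod.splits)
    ultimately show ?case by (intro exI[of _ "a' # W"]) (auto intro: path.path_Cons)
  qed (auto intro: exI[of _ "[]"] path_Nil)
  obtain W where W: "path T h W 0" "u (vs ! 0) = map lab W"
    using main[of h "u (vs ! 0)" 0] u[OF node_less[of 0]] node_less[of 0]
    by (auto simp: transitions_main Ts initial_def machine_prot)
  define l where "l = m - 1"
  have l: "l < m" "0 < m" using m_pos by (auto simp: l_def)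
  \<comment> \<open>On a self-loop, where \<open>l = 0\<close>, writing and consuming use the same
    edge and are told apart by send against receive.\<close>
  have ne: "l \<noteq> 0 \<or> fwd l \<noteq> (\<not> fwd 0)" by auto
  have lab_Cons:
    "?act (fwd 0) (cs ! 0) (lab (s, b) # v) =
      (if s then msg (cs ! 0) b # ?act (fwd 0) (cs ! 0) v else ?act (fwd 0) (cs ! 0) v)"
    "?act (\<not> fwd l) (cs ! l) (lab (s, b) # v) =
      (if s then ?act (\<not> fwd l) (cs ! l) v else msg (cs ! l) b # ?act (\<not> fwd l) (cs ! l) v)" for s b v
    unfolding lab_def l_def[symmetric] fst_conv snd_conv
    by (cases s; use ne in \<open>auto simp only: lop[OF l(1) l(1)] lop[OF l(1) l(2)] lop[OF l(2) l(1)]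
          lop[OF l(2) l(2)] if_True if_False split: if_splits\<close>)+
  have lab: "?act (fwd 0) (cs ! 0) (map lab W) = map (msg (cs ! 0)) (written W)"
    "?act (\<not> fwd l) (cs ! l) (map lab W) = map (msg (cs ! l)) (consumed W)" for W
  proof (induction W)
    case (Cons a W)
    obtain s b where "a = (s, b)" by (cases a)
    then show "?act (fwd 0) (cs ! 0) (map lab (a # W)) = map (msg (cs ! 0)) (written (a # W))"
      "?act (\<not> fwd l) (cs ! l) (map lab (a # W)) = map (msg (cs ! l)) (consumed (a # W))"
      using Cons by (cases s; simp add: lab_Cons del: actions_simps(2))+
  qed simp_all
  have "?act (fwd k) (cs ! k) (u (vs ! k)) = map (msg (cs ! k)) (written W)" if "k < m" for k
    using that
  proof (induction k)
    case 0
    then show ?case using lab W(2) by simp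
  next
    case (Suc k)
    then show ?case using copy[of "Suc k" "written W"] edge[of k] by simp
  qed
  from this[OF l(1)] edge[OF l(1)]
  have "?act (\<not> fwd l) (cs ! l) (u (vs ! Suc l)) = map (msg (cs ! l)) (written W)" by simp
  moreover have "vs ! Suc l = vs ! 0" using m_pos closed by (simp add: l_def)
  ultimately have "map (msg (cs ! l)) (written W) = map (msg (cs ! l)) (consumed W)"
    using lab W(2) by simp
  then have "written W = consumed W" by (simp add: inj_map_eq_map[OF inj_msg])
  then show ?thesis using W by blast
qed

section \<open>Protocol runs that realise a queue computation\<close>

definition chan :: "(nat \<Rightarrow> bool list) \<Rightarrow> nat list list" where
  "chan X = map (\<lambda>\<xi>. map (msg \<xi>) (X \<xi>)) [0..<length es]"

text \<open>A relation between the channel word before and after an action, so that actions of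
  unknown direction can be treated uniformly.\<close>

definition effect :: "bool \<Rightarrow> bool \<Rightarrow> bool list \<Rightarrow> bool list \<Rightarrow> bool" where
  "effect s b x y \<longleftrightarrow> (if s then y = x @ [b] else x = b # y)"

lemma chan_nth: "\<xi> < length es \<Longrightarrow> chan X ! \<xi> = map (msg \<xi>) (X \<xi>)"
  by (simp add: chan_def)

lemma chan_update: "\<xi> < length es \<Longrightarrow> (chan X)[\<xi> := map (msg \<xi>) y] = chan (X(\<xi> := y))"
  by (rule nth_equalityI) (auto simp: chan_def nth_list_update)

lemma step_effect:
  assumes "i < n" "\<xi> < length es" "(S ! i, s, msg \<xi> b, q) \<in> transitions (prot M) i"
    "(if s then fst (es ! \<xi>) else snd (es ! \<xi>)) = i" "effect s b (X \<xi>) y"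
  shows "step n es (prot M) (S, chan X) (S[i := q], chan (X(\<xi> := y)))"
proof (cases s)
  case True
  then have "step n es (prot M) (S, chan X) (S[i := q], (chan X)[\<xi> := chan X ! \<xi> @ [msg \<xi> b]])"
    using assms by (intro step_send) (auto simp: msg_in_msg_of)
  moreover have "chan X ! \<xi> @ [msg \<xi> b] = map (msg \<xi>) y"
    using True assms by (simp add: chan_nth effect_def)
  ultimately show ?thesis using assms(2) by (simp add: chan_update)
next
  case False
  then have "step n es (prot M) (S, chan X) (S[i := q], (chan X)[\<xi> := map (msg \<xi>) y])"
    using assms by (intro step_recv[where b="msg \<xi> b"]) (auto simp: msg_in_msg_of chan_nth effect_def)
  then show ?thesis using assms(2) by (simp add: chan_update)
qed

lemma trans_of_fst_snd: "trans_of (p, a, q) = (p, fst a, snd a, q)"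
  by (cases a) (simp add: trans_of_def)

abbreviation steps :: "fsm \<Rightarrow> nat list \<times> nat list list \<Rightarrow> nat list \<times> nat list list \<Rightarrow> bool" where
  "steps M \<equiv> (step n es (prot M))\<^sup>*\<^sup>*"

lemma lop_step:
  assumes "k < m" "(S ! (vs ! k), fst (lop k b), snd (lop k b), q) \<in> transitions (prot M) (vs ! k)"
    "effect (fwd k) b (X (cs ! k)) y"
  shows "step n es (prot M) (S, chan X) (S[vs ! k := q], chan (X(cs ! k := y)))"
  using assms edge_endpoints[OF assms(1)]
  by (intro step_effect[where s="fwd k" and b=b]) (auto simp: lop_def edge_less intro: node_less)

lemma rop_step:
  assumes "k < m" "i = vs ! Suc k"
    "(S ! i, fst (rop k b), snd (rop k b), q) \<in> transitions (prot M) i"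
    "effect (\<not> fwd k) b (X (cs ! k)) y"
  shows "step n es (prot M) (S, chan X) (S[i := q], chan (X(cs ! k := y)))"
  using assms edge_endpoints[OF assms(1)]
  by (intro step_effect[where s="\<not> fwd k" and b=b]) (auto simp: rop_def edge_less intro: node_less)

lemma copy_node_pass:
  assumes k: "0 < k" "k < m" and S: "length S = n" "S ! (vs ! k) = 0"
    and y: "effect (\<not> fwd (k - 1)) b (X (cs ! (k - 1))) y" and z: "effect (fwd k) b (X (cs ! k)) z"
  shows "steps M (S, chan X) (S, chan (X(cs ! (k - 1) := y, cs ! k := z)))"
proof -
  let ?i = "vs ! k" and ?T = "transitions (prot M) (vs ! k)"
  have i: "?i < n" "?i = vs ! Suc (k - 1)" using node_less[of k] k by auto
  have ne: "cs ! (k - 1) \<noteq> cs ! k" using k by (simp add: edge_eq_iff)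
  let ?S = "S[?i := hold b]"
  have S': "?S ! ?i = hold b" "?S[?i := 0] = S" 
    using S i(1) list_update_id[of S ?i] by simp_all
  have T: "(S ! ?i, fst (first_op k b), snd (first_op k b), hold b) \<in> ?T"
    "(?S ! ?i, fst (second_op k b), snd (second_op k b), 0) \<in> ?T"
    unfolding transitions_copy[OF k] S'(1) S(2) trans_of_fst_snd[symmetric] by blast+
  show ?thesis
  proof (cases "fwd (k - 1)")
    case True
    have "step n es (prot M) (S, chan X) (?S, chan (X(cs ! (k - 1) := y)))"
      using T(1) y True k by (intro rop_step[OF _ i(2)]) (auto simp: first_op_def)
    moreover have "step n es (prot M) (?S, chan (X(cs ! (k - 1) := y)))
        (?S[?i := 0], chan (X(cs ! (k - 1) := y, cs ! k := z)))"
      using T(2) z True k ne by (intro lop_step) (auto simp: second_op_def)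
    ultimately show ?thesis unfolding S'(2) by (meson converse_rtranclp_into_rtranclp r_into_rtranclp)
  next
    case False
    have "step n es (prot M) (S, chan X) (?S, chan (X(cs ! k := z)))"
      using T(1) z False k by (intro lop_step) (auto simp: first_op_def)
    moreover have "step n es (prot M) (?S, chan (X(cs ! k := z)))
        (?S[?i := 0], chan (X(cs ! k := z, cs ! (k - 1) := y)))"
      using T(2) y False k ne by (intro rop_step[OF _ i(2)]) (auto simp: second_op_def)
    ultimately show ?thesis unfolding S'(2) fun_upd_twist[OF ne]
      by (meson converse_rtranclp_into_rtranclp r_into_rtranclp)
  qed
qed

text \<open>Whether the first node of the path moves before or after all others is dictated by the
  orientation of the edge that joins it to them.\<close>

lemma copy_path_pass:
  assumes "i + Suc d < m" "length S = n" "\<And>k. 0 < k \<Longrightarrow> k < m \<Longrightarrow> S ! (vs ! k) = 0"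
    and "\<And>k. i < k \<Longrightarrow> k < i + Suc d \<Longrightarrow> X (cs ! k) = []"
    and "effect (\<not> fwd i) b (X (cs ! i)) y" "effect (fwd (i + Suc d)) b (X (cs ! (i + Suc d))) z"
  shows "steps M (S, chan X) (S, chan (X(cs ! i := y, cs ! (i + Suc d) := z)))"
  using assms
proof (induction d arbitrary: i X y z)
  case 0
  then show ?case using copy_node_pass[of "Suc i" S b X y z M] by (simp add: fun_upd_def)
next
  case (Suc d)
  let ?j = "i + Suc (Suc d)" and ?c = "cs ! Suc i"
  have ne: "cs ! i \<noteq> ?c" "cs ! ?j \<noteq> ?c" "cs ! i \<noteq> cs ! ?j"
    using Suc.prems(1) by (auto simp: edge_eq_iff)
  have inner: "cs ! k \<noteq> cs ! i" "cs ! k \<noteq> ?c" "cs ! k \<noteq> cs ! ?j" if "Suc i < k" "k < ?j" for k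
    using Suc.prems(1) that by (auto simp: edge_eq_iff)
  have empty: "X ?c = []" using Suc.prems(4) by simp
  have bounds: "Suc i + Suc d < m" "0 < Suc i" "Suc i < m" using Suc.prems(1) by auto
  show ?case
  proof (cases "fwd (Suc i)")
    case True
    define X' where "X' = X(cs ! i := y, ?c := [b])"
    have X': "X' (cs ! k) = []" if "Suc i < k" "k < ?j" for k
      using ne inner[OF that] Suc.prems(4)[of k] that by (auto simp: X'_def)
    have 1: "steps M (S, chan X) (S, chan X')"
      using copy_node_pass[OF bounds(2,3) Suc.prems(2) Suc.prems(3)[OF bounds(2,3)], of b X y "[b]" M]
        Suc.prems(5) True empty
      by (simp add: effect_def X'_def)
    have 2: "steps M (S, chan X') (S, chan (X'(?c := [], cs ! (Suc i + Suc d) := z)))"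
    proof (rule Suc.IH[OF bounds(1) Suc.prems(2,3)])
      show "X' (cs ! k) = []" if "Suc i < k" "k < Suc i + Suc d" for k using X' that by simp
      show "effect (\<not> fwd (Suc i)) b (X' ?c) []" using True by (simp add: effect_def X'_def)
      show "effect (fwd (Suc i + Suc d)) b (X' (cs ! (Suc i + Suc d))) z"
        using Suc.prems(6) ne by (simp add: X'_def)
    qed
    have 3: "X'(?c := [], cs ! (Suc i + Suc d) := z) = X(cs ! i := y, cs ! ?j := z)"
      using ne empty by (intro ext) (simp add: X'_def)
    show ?thesis using 1 2 unfolding 3 by (rule rtranclp_trans)
  next
    case False
    define X' where "X' = X(?c := [b], cs ! (Suc i + Suc d) := z)"
    have 1: "steps M (S, chan X) (S, chan X')"
      unfolding X'_def
    proof (rule Suc.IH[OF bounds(1) Suc.prems(2,3)])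
      show "X (cs ! k) = []" if "Suc i < k" "k < Suc i + Suc d" for k
        using Suc.prems(4) that by simp
      show "effect (\<not> fwd (Suc i)) b (X ?c) [b]" using False empty by (simp add: effect_def)
      show "effect (fwd (Suc i + Suc d)) b (X (cs ! (Suc i + Suc d))) z"
        using Suc.prems(6) by simp
    qed
    have 2: "steps M (S, chan X') (S, chan (X'(cs ! (Suc i - 1) := y, ?c := [])))"
    proof (rule copy_node_pass[OF bounds(2,3) Suc.prems(2) Suc.prems(3)[OF bounds(2,3)]])
      show "effect (\<not> fwd (Suc i - 1)) b (X' (cs ! (Suc i - 1))) y"
        using Suc.prems(5) ne by (simp add: X'_def)
      show "effect (fwd (Suc i)) b (X' ?c) []" using False ne by (simp add: effect_def X'_def)
    qed
    have 3: "X'(cs ! (Suc i - 1) := y, ?c := []) = X(cs ! i := y, cs ! ?j := z)"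
      using ne empty by (intro ext) (simp add: X'_def)
    show ?thesis using 1 2 unfolding 3 by (rule rtranclp_trans)
  qed
qed

abbreviation c0 :: nat where "c0 \<equiv> cs ! 0"
abbreviation cl :: nat where "cl \<equiv> cs ! (m - 1)"

definition conf :: "nat \<Rightarrow> (nat \<Rightarrow> bool list) \<Rightarrow> nat list \<times> nat list list" where
  "conf p X = ((replicate n 0)[vs ! 0 := p], chan X)"

lemma conf_copy_pass:
  assumes "1 < m" "\<And>\<xi>. \<xi> \<noteq> c0 \<Longrightarrow> \<xi> \<noteq> cl \<Longrightarrow> X \<xi> = []"
    "effect (\<not> fwd 0) b (X c0) y" "effect (fwd (m - 1)) b (X cl) z"
  shows "steps M (conf p X) (conf p (X(c0 := y, cl := z)))"
proof -
  have d: "0 + Suc (m - 2) = m - 1" using assms(1) by simp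
  have "X (cs ! k) = []" if "0 < k" "k < m - 1" for k
  proof (rule assms(2))
    have "k < m" using that(2) by simp
    then show "cs ! k \<noteq> c0" "cs ! k \<noteq> cl"
      using that m_pos edge_eq_iff[of k 0] edge_eq_iff[of k "m - 1"] by simp_all
  qed
  moreover have "(replicate n 0)[vs ! 0 := p] ! (vs ! k) = 0" if "0 < k" "k < m" for k
    using that m_pos node_eq_iff[of k 0] node_less[of k] by simp
  ultimately show ?thesis
    unfolding conf_def
    using copy_path_pass[of 0 "m - 2" "(replicate n 0)[vs ! 0 := p]" X b y z M, unfolded d] assms
    by simp
qed

lemma conf_write:
  assumes "(p, (True, b), q) \<in> T" "set Ts = relabel ` T" "effect (fwd 0) b (X c0) y"
  shows "step n es (prot (Ks, h, Ts)) (conf p X) (conf q (X(c0 := y)))"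
proof -
  have "(p, fst (lop 0 b), snd (lop 0 b), q) \<in> set Ts"
    unfolding assms(2) using imageI[OF assms(1), of relabel]
    by (simp add: relabel_def lab_def trans_of_fst_snd)
  then show ?thesis
    unfolding conf_def
    using lop_step[of 0 "(replicate n 0)[vs ! 0 := p]" b q "(Ks, h, Ts)" X y] assms(3) m_pos node_less[of 0]
    by (simp add: transitions_main)
qed

lemma conf_consume:
  assumes "(p, (False, b), q) \<in> T" "set Ts = relabel ` T" "effect (\<not> fwd (m - 1)) b (X cl) y"
  shows "step n es (prot (Ks, h, Ts)) (conf p X) (conf q (X(cl := y)))"
proof -
  have "(p, fst (rop (m - 1) b), snd (rop (m - 1) b), q) \<in> set Ts"
    unfolding assms(2) using imageI[OF assms(1), of relabel]
    by (simp add: relabel_def lab_def trans_of_fst_snd)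
  then show ?thesis
    unfolding conf_def
    using rop_step[of "m - 1" "vs ! 0" "(replicate n 0)[vs ! 0 := p]" b q "(Ks, h, Ts)" X y]
      assms(3) m_pos node_less[of 0] closed
    by (simp add: transitions_main)
qed

text \<open>Between actions the whole queue rests on the last edge: a letter written on edge 0 is at
  once passed along by the copying nodes, and on a self-loop it is there already. Only the two edges
  at the base node have to point forward; those in between may have any orientation.\<close>

lemma run_directed:
  assumes "fwd 0" "fwd (m - 1)" "set Ts = relabel ` T" "qrun x w x'" "path T p w q"
  shows "steps (Ks, h, Ts) (conf p ((\<lambda>_. [])(cl := x))) (conf q ((\<lambda>_. [])(cl := x')))"
  using assms(4,5)
proof (induction arbitrary: p rule: qrun.induct)
  case (qrun_Nil x)
  then have "q = p" by (auto elim: path.cases)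
  then show ?case by simp
next
  case (qrun_write x b w x')
  from qrun_write.prems obtain r where r: "(p, (True, b), r) \<in> T" "path T r w q"
    by (auto elim: path.cases)
  let ?X = "(\<lambda>_. [])(cl := x)"
  have step: "step n es (prot (Ks, h, Ts)) (conf p ?X) (conf r (?X(c0 := ?X c0 @ [b])))"
    by (rule conf_write[OF r(1) assms(3)]) (simp add: effect_def assms(1))
  have "steps (Ks, h, Ts) (conf r (?X(c0 := ?X c0 @ [b]))) (conf r ((\<lambda>_. [])(cl := x @ [b])))"
  proof (cases "1 < m")
    case True
    then have ne: "c0 \<noteq> cl" using m_pos edge_eq_iff[of 0 "m - 1"] by simp
    let ?Y = "?X(c0 := ?X c0 @ [b])"
    have 1: "steps (Ks, h, Ts) (conf r ?Y) (conf r (?Y(c0 := [], cl := x @ [b])))"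
      using True ne assms(1,2) by (intro conf_copy_pass) (auto simp: effect_def)
    have 2: "?Y(c0 := [], cl := x @ [b]) = (\<lambda>_. [])(cl := x @ [b])"
      using ne by (intro ext) simp
    show ?thesis using 1 unfolding 2 .
  next
    case False
    then have "m - 1 = 0" by simp
    then show ?thesis by simp
  qed
  with step have "steps (Ks, h, Ts) (conf p ?X) (conf r ((\<lambda>_. [])(cl := x @ [b])))"
    by (rule converse_rtranclp_into_rtranclp)
  then show ?case using qrun_write.IH[OF r(2)] by (rule rtranclp_trans)
next
  case (qrun_consume x w x' b)
  from qrun_consume.prems obtain r where r: "(p, (False, b), r) \<in> T" "path T r w q"
    by (auto elim: path.cases)
  have "step n es (prot (Ks, h, Ts)) (conf p ((\<lambda>_. [])(cl := b # x)))
      (conf r (((\<lambda>_. [])(cl := b # x))(cl := x)))"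
    using assms(2) by (intro conf_consume[OF r(1) assms(3)]) (simp add: effect_def)
  then show ?case
    using qrun_consume.IH[OF r(2)] unfolding fun_upd_upd by (rule converse_rtranclp_into_rtranclp)
qed

text \<open>The base node only sends, so it is never blocked and executes the whole word alone. The
  two projections pile up on its edges until \<open>copy_path_drain\<close> removes them.\<close>

lemma run_source:
  assumes "fwd 0" "\<not> fwd (m - 1)" "c0 \<noteq> cl" "set Ts = relabel ` T" "path T p w q"
  shows "steps (Ks, h, Ts) (conf p X) (conf q (X(c0 := X c0 @ written w, cl := X cl @ consumed w)))"
  using assms(5)
proof (induction arbitrary: X rule: path.induct)
  case (path_Nil p)
  show ?case by simp
next
  case (path_Cons p a q w r)
  obtain s b where a: "a = (s, b)" by (cases a)
  let ?X = "if s then X(c0 := X c0 @ [b]) else X(cl := X cl @ [b])"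
  have 1: "step n es (prot (Ks, h, Ts)) (conf p X) (conf q ?X)"
    using path_Cons(1) a assms
      conf_write[of p b q T Ts X "X c0 @ [b]" Ks h] conf_consume[of p b q T Ts X "X cl @ [b]" Ks h]
    by (cases s) (simp_all add: effect_def)
  have 2: "?X(c0 := ?X c0 @ written w, cl := ?X cl @ consumed w) =
      X(c0 := X c0 @ written (a # w), cl := X cl @ consumed (a # w))"
    using assms(3) a by (cases s; intro ext; simp)
  show ?case using 1 path_Cons.IH[of ?X] unfolding 2 by (rule converse_rtranclp_into_rtranclp)
qed

text \<open>The time reversal of \<open>run_source\<close>: the base node only receives, so both
  projections must lie complete on its edges beforehand. They are supplied by
  \<open>copy_path_fill\<close>.\<close>

lemma run_sink:
  assumes "\<not> fwd 0" "fwd (m - 1)" "c0 \<noteq> cl" "set Ts = relabel ` T" "path T p w q"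
  shows "steps (Ks, h, Ts) (conf p (X(c0 := written w, cl := consumed w))) (conf q (X(c0 := [], cl := [])))"
  using assms(5)
proof (induction rule: path.induct)
  case (path_Nil p)
  show ?case by simp
next
  case (path_Cons p a q w r)
  obtain s b where a: "a = (s, b)" by (cases a)
  let ?X = "X(c0 := written (a # w), cl := consumed (a # w))"
  have 1: "step n es (prot (Ks, h, Ts)) (conf p ?X)
      (conf q (if s then ?X(c0 := written w) else ?X(cl := consumed w)))"
    using path_Cons(1) a assms
      conf_write[of p b q T Ts ?X "written w" Ks h] conf_consume[of p b q T Ts ?X "consumed w" Ks h]
    by (cases s) (simp_all add: effect_def)
  have 2: "(if s then ?X(c0 := written w) else ?X(cl := consumed w)) =
      X(c0 := written w, cl := consumed w)"
    using assms(3) a by (cases s; intro ext; simp)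
  show ?case using 1 path_Cons.IH unfolding 2 by (rule converse_rtranclp_into_rtranclp)
qed

text \<open>Both end edges point into the path of copying nodes, so passing a letter removes it from
  the front of both words; equal words cancel.\<close>

lemma copy_path_drain:
  assumes "1 < m" "fwd 0" "\<not> fwd (m - 1)" "c0 \<noteq> cl"
  shows "steps M (conf p ((\<lambda>_. [])(c0 := x, cl := x))) (conf p (\<lambda>_. []))"
proof (induction x)
  case Nil
  have "(\<lambda>_. [])(c0 := [], cl := []) = (\<lambda>_. [] :: bool list)" by (intro ext) simp
  then show ?case by simp
next
  case (Cons b x)
  let ?X = "(\<lambda>_. [])(c0 := b # x, cl := b # x)"
  have 1: "steps M (conf p ?X) (conf p (?X(c0 := x, cl := x)))"
    using assms by (intro conf_copy_pass[where b=b]) (auto simp: effect_def)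
  have 2: "?X(c0 := x, cl := x) = (\<lambda>_. [])(c0 := x, cl := x)" by (intro ext) simp
  show ?case using 1 Cons unfolding 2 by (rule rtranclp_trans)
qed

text \<open>Both end edges point out of the path of copying nodes, which can therefore invent a
  letter and emit it at both ends. Letters join the rear, hence the reverse induction.\<close>

lemma copy_path_fill:
  assumes "1 < m" "\<not> fwd 0" "fwd (m - 1)" "c0 \<noteq> cl"
  shows "steps M (conf p (\<lambda>_. [])) (conf p ((\<lambda>_. [])(c0 := x, cl := x)))"
proof (induction x rule: rev_induct)
  case Nil
  have "(\<lambda>_. [])(c0 := [], cl := []) = (\<lambda>_. [] :: bool list)" by (intro ext) simp
  then show ?case by simp
next
  case (snoc b x)
  let ?X = "(\<lambda>_. [])(c0 := x, cl := x)"
  have 1: "steps M (conf p ?X) (conf p (?X(c0 := x @ [b], cl := x @ [b])))"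
    using assms by (intro conf_copy_pass[where b=b]) (auto simp: effect_def)
  have 2: "?X(c0 := x @ [b], cl := x @ [b]) = (\<lambda>_. [])(c0 := x @ [b], cl := x @ [b])"
    by (intro ext) simp
  show ?case using snoc 1 unfolding 2 by (rule rtranclp_trans)
qed

lemma stable_complete:
  assumes Ts: "set Ts = relabel ` T" and W: "path T h W 0" "qrun [] W []"
  shows "stable_cs n es (prot (Ks, h, Ts)) (replicate n 0)"
proof -
  let ?P = "prot (Ks, h, Ts)"
  have eq: "written W = consumed W" using qrun_written_consumed[OF W(2)] by simp
  have "map (initial ?P) [0..<n] = (replicate n 0)[vs ! 0 := h]"
    by (rule nth_equalityI)
      (auto simp: initial_def machine_prot side_machine_def nth_list_update)
  moreover have empty: "replicate (length es) [] = chan (\<lambda>_. [])"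
    by (rule nth_equalityI) (auto simp: chan_def)
  ultimately have init: "initial_global n es ?P = conf h (\<lambda>_. [])"
    by (simp add: initial_global_def conf_def)
  have final: "(replicate n 0, replicate (length es) []) = conf 0 (\<lambda>_. [])"
    unfolding empty conf_def using list_update_id[of "replicate n (0 :: nat)" "vs ! 0"] node_less[of 0] by simp
  have ne: "1 < m \<and> c0 \<noteq> cl" if "fwd 0 \<noteq> fwd (m - 1)"
  proof -
    have "m - 1 \<noteq> 0" using that by metis
    then show ?thesis using m_pos edge_eq_iff[of 0 "m - 1"] by simp
  qed
  have nil: "(\<lambda>_. [])(cl := []) = (\<lambda>_. [] :: bool list)" by (intro ext) simp
  consider "fwd 0" "fwd (m - 1)" | "fwd 0" "\<not> fwd (m - 1)" | "\<not> fwd 0" "fwd (m - 1)"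
    using orient_fwd by blast
  then have "steps (Ks, h, Ts) (conf h (\<lambda>_. [])) (conf 0 (\<lambda>_. []))"
  proof cases
    case 1
    then show ?thesis using run_directed[OF _ _ Ts W(2,1)] nil by simp
  next
    case 2
    then have "1 < m" "c0 \<noteq> cl" using ne by auto
    with 2 have "steps (Ks, h, Ts) (conf h (\<lambda>_. []))
        (conf 0 ((\<lambda>_. [])(c0 := consumed W, cl := consumed W)))"
      "steps (Ks, h, Ts) (conf 0 ((\<lambda>_. [])(c0 := consumed W, cl := consumed W))) (conf 0 (\<lambda>_. []))"
      using run_source[OF _ _ _ Ts W(1), of Ks h "\<lambda>_. []"] copy_path_drain eq by simp_all
    then show ?thesis by (rule rtranclp_trans)
  next
    case 3
    then have "1 < m" "c0 \<noteq> cl" using ne by auto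
    moreover have "(\<lambda>_. [])(c0 := [], cl := []) = (\<lambda>_. [] :: bool list)" by (intro ext) simp
    ultimately have "steps (Ks, h, Ts) (conf h (\<lambda>_. []))
        (conf h ((\<lambda>_. [])(c0 := consumed W, cl := consumed W)))"
      "steps (Ks, h, Ts) (conf h ((\<lambda>_. [])(c0 := consumed W, cl := consumed W))) (conf 0 (\<lambda>_. []))"
      using 3 run_sink[OF _ _ _ Ts W(1), of Ks h "\<lambda>_. []"] copy_path_fill eq by simp_all
    then show ?thesis by (rule rtranclp_trans)
  qed
  then show ?thesis unfolding stable_cs_def init final .
qed

section \<open>Undecidability\<close>

text \<open>Channels are empty initially, so the machine writes its input itself: from
  \<open>2 * e + 1\<close> it counts down through the odd states to the initial state 1 of the
  automaton.\<close>

definition chain_set :: "nat \<Rightarrow> (nat \<times> (bool \<times> bool) \<times> nat) set" where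
  "chain_set e = {(2 * k + 3, (True, False), 2 * k + 1) |k. k < e}"

lemma path_chain_set:
  assumes T: "\<And>p a q. (p, a, q) \<in> T \<Longrightarrow> (p = 1 \<or> even p) \<and> (q = 1 \<or> even q)"
  shows "path (chain_set e \<union> T) (2 * e + 1) W 0 \<longleftrightarrow>
    (\<exists>w. W = replicate e (True, False) @ w \<and> path T 1 w 0)"
proof
  \<comment> \<open>Chain transitions start in odd states from 3 on, which transitions of
    \<open>T\<close> never enter, so the chain is not entered again.\<close>
  have tail: "path T p w q" if "path (chain_set e \<union> T) p w q" "p = 1 \<or> even p" for p w q
    using that
  proof (induction rule: path.induct)
    case (path_Cons p a q w r)
    then have "(p, a, q) \<in> T" by (auto simp: chain_set_def)
    then show ?case using path_Cons T[of p a q] by (auto intro: path.path_Cons)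
  qed (rule path_Nil)
  have "\<exists>w. W = replicate k (True, False) @ w \<and> path T 1 w 0"
    if "path (chain_set e \<union> T) (2 * k + 1) W 0" for k
    using that
  proof (induction k arbitrary: W)
    case 0
    then show ?case using tail[of 1 W 0] by simp
  next
    case (Suc k)
    from Suc.prems obtain a q w where W: "W = a # w" "(2 * Suc k + 1, a, q) \<in> chain_set e \<union> T"
      "path (chain_set e \<union> T) q w 0"
      by cases auto
    have "(2 * Suc k + 1, a, q) \<notin> T"
    proof
      assume "(2 * Suc k + 1, a, q) \<in> T"
      from T[OF this] show False by auto
    qed
    then have "a = (True, False)" "q = 2 * k + 1" using W(2) by (auto simp: chain_set_def)
    then show ?case using Suc.IH[of w] W by auto
  qed
  then show "path (chain_set e \<union> T) (2 * e + 1) W 0 \<Longrightarrow>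
    \<exists>w. W = replicate e (True, False) @ w \<and> path T 1 w 0" by blast
next
  assume "\<exists>w. W = replicate e (True, False) @ w \<and> path T 1 w 0"
  then obtain w where W: "W = replicate e (True, False) @ w" "path T 1 w 0" by blast
  have "path T' p w q" if "path T p w q" "T \<subseteq> T'" for T T' :: "(nat \<times> (bool \<times> bool) \<times> nat) set" and p w q
    using that by (induction rule: path.induct) (auto intro: path.intros)
  from this[OF W(2)] have w: "path (chain_set e \<union> T) 1 w 0" by blast
  have "path (chain_set e \<union> T) (2 * k + 1) (replicate k (True, False) @ w) 0" if "k \<le> e" for k
    using that
  proof (induction k)
    case 0
    then show ?case using w by simp
  next
    case (Suc k)
    then have "(2 * Suc k + 1, (True, False), 2 * k + 1) \<in> chain_set e \<union> T"
      by (auto simp: chain_set_def)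
    then show ?case using Suc by (auto intro: path_Cons)
  qed
  then show "path (chain_set e \<union> T) (2 * e + 1) W 0" using W(1) by blast
qed

definition chain_trans :: "nat \<Rightarrow> trans" where
  "chain_trans k = relabel (2 * k + 3, (True, False), 2 * k + 1)"

text \<open>The states reach up to \<open>2 * e + 1\<close>, where the chain begins, and include
  those of the automaton as soon as these are bounded by \<open>e\<close>.\<close>

definition main_machine :: "nat \<Rightarrow> trans list \<Rightarrow> fsm" where
  "main_machine e Ts = (rev [0..<2 * e + 2], 2 * e + 1, rev (map chain_trans [0..<e]) @ Ts)"

lemma main_machine_trans:
  "set Ts = relabel ` T \<Longrightarrow> set (rev (map chain_trans [0..<e]) @ Ts) = relabel ` (chain_set e \<union> T)"
  by (auto simp: chain_set_def chain_trans_def image_iff)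

lemma stable_main_machine_iff:
  assumes T: "\<And>p a q. (p, a, q) \<in> T \<Longrightarrow> (p = 1 \<or> even p) \<and> (q = 1 \<or> even q)"
    and Ts: "set Ts = relabel ` T"
    and complete: "halts \<Longrightarrow> \<exists>w. path T 1 w 0 \<and> qrun (replicate e False) w []"
    and sound: "\<And>w. path T 1 w 0 \<Longrightarrow> replicate e False @ written w = consumed w \<Longrightarrow> halts"
  shows "stable_cs n es (prot (main_machine e Ts)) (replicate n 0) \<longleftrightarrow> halts"
proof
  assume "stable_cs n es (prot (main_machine e Ts)) (replicate n 0)"
  then obtain W where W: "path (chain_set e \<union> T) (2 * e + 1) W 0" "written W = consumed W"
    using stable_sound[OF main_machine_trans[OF Ts]] unfolding main_machine_def by blast
  then obtain w where w: "W = replicate e (True, False) @ w" "path T 1 w 0"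
    using path_chain_set[of T e W] T by blast
  have "written (replicate e (True, False)) = replicate e False"
    "consumed (replicate e (True, False)) = []" by (induction e) auto
  then show halts using W(2) w by (intro sound[OF w(2)]) simp
next
  assume halts
  then obtain w where w: "path T 1 w 0" "qrun (replicate e False) w []" using complete by blast
  have "path (chain_set e \<union> T) (2 * e + 1) (replicate e (True, False) @ w) 0"
    using path_chain_set[of T e "replicate e (True, False) @ w"] T w(1) by blast
  moreover have "qrun [] (replicate e (True, False) @ w) []"
    using qrun_append[OF qrun_write_all[of "[]" "replicate e False"]] w(2) by simp
  ultimately show "stable_cs n es (prot (main_machine e Ts)) (replicate n 0)"
    unfolding main_machine_def by (rule stable_complete[OF main_machine_trans[OF Ts]])
qed

lemma relabel_ok:
  assumes "(p, s, b, q) = relabel (p', a, q')"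
  shows "p = p' \<and> q = q' \<and> (\<exists>\<xi><length es. b \<in> msg_of (prot M) \<xi> \<and>
    (if s then fst (es ! \<xi>) = vs ! 0 else snd (es ! \<xi>) = vs ! 0))"
proof -
  have "m - 1 < m" "Suc (m - 1) = m" using m_pos by auto
  then show ?thesis
    using assms edge_endpoints[of 0] edge_endpoints[of "m - 1"] m_pos edge_less closed
    by (cases "fst a")
      (auto simp: relabel_def trans_of_fst_snd lab_def lop_def rop_def msg_in_msg_of)
qed

lemma copy_trans_ok:
  assumes "(p, s, b, q) \<in> set (copy_trans k)" "0 < k" "k < m"
  shows "p \<in> {0, 1, 2} \<and> q \<in> {0, 1, 2} \<and> (\<exists>\<xi><length es. b \<in> msg_of (prot M) \<xi> \<and>
    (if s then fst (es ! \<xi>) = vs ! k else snd (es ! \<xi>) = vs ! k))"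
proof -
  have "k - 1 < m" "Suc (k - 1) = k" using assms by auto
  then show ?thesis
    using assms edge_endpoints[of k] edge_endpoints[of "k - 1"] edge_less[of k] edge_less[of "k - 1"]
    by (cases "fwd (k - 1)")
      (auto simp: copy_trans_def trans_of_fst_snd first_op_def second_op_def lop_def rop_def
        hold_def msg_in_msg_of)
qed

lemma instance_ok_main_machine:
  assumes Ts: "set Ts = relabel ` T" and bound: "\<And>p a q. (p, a, q) \<in> T \<Longrightarrow> p \<le> e \<and> q \<le> e"
  shows "instance_ok n es (prot (main_machine e Ts), replicate n 0)"
proof -
  let ?P = "prot (main_machine e Ts)"
  have "\<forall>(p, s, b, q) \<in> transitions ?P j. p \<in> states ?P j \<and> q \<in> states ?P j \<and>
      (\<exists>\<xi><length es. b \<in> msg_of ?P \<xi> \<and> (if s then fst (es ! \<xi>) = j else snd (es ! \<xi>) = j))"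
    if "j < n" for j
  proof (cases "j = vs ! 0")
    case True
    have tr: "transitions ?P j = relabel ` (chain_set e \<union> T)"
      unfolding True main_machine_def transitions_main by (rule main_machine_trans[OF Ts])
    have st: "states ?P j = {..<2 * e + 2}"
      using that True by (auto simp: states_def machine_prot main_machine_def)
    have "p < 2 * e + 2 \<and> q < 2 * e + 2" if "(p, a, q) \<in> chain_set e \<union> T" for p a q
      using that bound[of p a q] by (auto simp: chain_set_def)
    then show ?thesis
      unfolding tr st using relabel_ok[where M="main_machine e Ts"] True by fast
  next
    case False
    have "{k \<in> {1..<m}. vs ! k = j} = {k. 0 < k \<and> k < m \<and> vs ! k = j}" by auto
    then have tr: "transitions ?P j = (\<Union>k \<in> {k. 0 < k \<and> k < m \<and> vs ! k = j}. set (copy_trans k))"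
      using that False by (simp add: transitions_def machine_prot side_machine_def)
    have st: "states ?P j = {0, 1, 2}"
      using that False by (auto simp: states_def machine_prot side_machine_def)
    show ?thesis
      unfolding tr st using copy_trans_ok[where M="main_machine e Ts"] by fast
  qed
  moreover have "initial ?P j \<in> states ?P j" "0 \<in> states ?P j" if "j < n" for j
    using that by (auto simp: initial_def states_def machine_prot main_machine_def side_machine_def)
  ultimately show ?thesis
    unfolding instance_ok_def protocol_ok_def composite_state_def
    by (auto simp: msg_of_prot) (auto simp: prot_def msgs_def)
qed

text \<open>The number \<open>e\<close> plays three roles: the code of the transitions of the simulating automaton,
  a bound on its states, and its input.\<close>

definition instance_code :: "nat \<Rightarrow> nat" where
  "instance_code e = prod_encode (list_encode [list_encode (map prod_encode msgs),
     list_encode (map (\<lambda>j. if j = vs ! 0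
       then list_encode [list_encode (rev [0..<2 * e + 2]), 2 * e + 1,
         list_encode (rev (map (\<lambda>k. enc_trans (chain_trans k)) [0..<e]) @ list_decode e)]
       else enc_fsm (side_machine j)) [0..<n])], list_encode (replicate n 0))"

text \<open>Decoding \<open>e\<close> yields a list of transition codes, the very form in which the
  code of a machine contains its transitions. The hypothesis is the self-reference that the diagonal
  argument supplies.\<close>

lemma enc_instance_main_machine:
  assumes "e = list_encode (map enc_trans Ts)"
  shows "enc_instance (prot (main_machine e Ts), replicate n 0) = instance_code e"
proof -
  have eq: "map (enc_fsm \<circ> (\<lambda>j. if j = vs ! 0 then main_machine e Ts else side_machine j)) [0..<n] =
    map (\<lambda>j. if j = vs ! 0
       then list_encode [list_encode (rev [0..<2 * e + 2]), 2 * e + 1,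
         list_encode (rev (map (\<lambda>k. enc_trans (chain_trans k)) [0..<e]) @ list_decode e)]
       else enc_fsm (side_machine j)) [0..<n]"
    unfolding assms
    by (rule map_cong[OF refl])
      (simp add: enc_fsm_def main_machine_def rev_map comp_def del: upt_Suc list_encode.simps)
  show ?thesis
    unfolding enc_instance_def enc_protocol_def instance_code_def prot_def fst_conv snd_conv map_map eq ..
qed

lemma computable_instance_code: "computable 1 (\<lambda>xs. instance_code (xs ! 0))"
proof -
  have double: "computable 1 (\<lambda>xs. 2 * xs ! 0 + c)" for c
    unfolding mult_2 by (intro computable_add computable_proj computable_const) simp_all
  have states: "computable 1 (\<lambda>xs. list_encode (rev [0..<2 * xs ! 0 + 2]))"
    using computable_list_encode_rev_iterate[where G="\<lambda>k. k" and L="\<lambda>_. []",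
        OF double[of 2] computable_const[of 1 0] computable_proj] by (simp del: upt_Suc)
  have "enc_trans (chain_trans k) =
      list_encode [2 * k + 3, if fwd 0 then 1 else 0, msg (cs ! 0) False, 2 * k + 1]" for k
    by (simp add: enc_trans_def chain_trans_def relabel_def trans_of_fst_snd lab_def lop_def)
  then have "computable 1 (\<lambda>xs. enc_trans (chain_trans (xs ! 0)))"
    unfolding list_encode.simps
    by (simp only:) (intro computable_Suc computable_prod_encode computable_const double)
  \<comment> \<open>The number \<open>e\<close> is itself the code of the tail
    \<open>list_decode e\<close>, so the iteration that prepends the chain starts at
    \<open>xs ! 0\<close>.\<close>
  then have trans: "computable 1 (\<lambda>xs.
      list_encode (rev (map (\<lambda>k. enc_trans (chain_trans k)) [0..<xs ! 0]) @ list_decode (xs ! 0)))"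
    by (intro computable_list_encode_rev_iterate[where B="\<lambda>xs. xs ! 0"] computable_proj) simp_all
  have main: "computable 1 (\<lambda>xs. list_encode [list_encode (rev [0..<2 * xs ! 0 + 2]), 2 * xs ! 0 + 1,
         list_encode (rev (map (\<lambda>k. enc_trans (chain_trans k)) [0..<xs ! 0]) @ list_decode (xs ! 0))])"
    unfolding list_encode.simps
    by (intro computable_Suc computable_prod_encode computable_const states double trans)
  have machines: "computable 1 (\<lambda>xs. list_encode (map (\<lambda>j. if j = vs ! 0
       then list_encode [list_encode (rev [0..<2 * xs ! 0 + 2]), 2 * xs ! 0 + 1,
         list_encode (rev (map (\<lambda>k. enc_trans (chain_trans k)) [0..<xs ! 0]) @ list_decode (xs ! 0))]
       else enc_fsm (side_machine j)) [0..<n]))"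
    by (intro computable_list_encode computable_if main computable_const)
  show ?thesis
    unfolding instance_code_def list_encode.simps(2)[of _ "[_]"] list_encode.simps(2)[of _ "[]"]
    by (intro computable_Suc computable_prod_encode computable_const machines)
qed

theorem stable_undecidable:
  "\<not> decidable_on enc_instance (instance_ok n es) (\<lambda>x. stable_cs n es (fst x) (snd x))"
proof
  assume "decidable_on enc_instance (instance_ok n es) (\<lambda>x. stable_cs n es (fst x) (snd x))"
  then obtain f where f: "\<And>x. instance_ok n es x \<Longrightarrow>
      reval f [enc_instance x] (if stable_cs n es (fst x) (snd x) then 1 else 0)"
    unfolding decidable_on_def by blast
  obtain t where t: "\<And>xs. length xs = 1 \<Longrightarrow> reval t xs (instance_code (xs ! 0))"
    using computable_instance_code unfolding computable_def by blast
  \<comment> \<open>On \<open>[y]\<close> the minimisation of \<open>RProj 1\<close> looks for an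
    \<open>n\<close> with \<open>y = 0\<close>: it stops at once if \<open>y\<close> is 0 and
    diverges otherwise. Thus \<open>D\<close> halts exactly when \<open>f\<close> rejects.\<close>
  define D where "D = RComp (RMin (RProj 1)) [RComp f [t]]"
  have D: "(\<exists>z. reval D [e] z) \<longleftrightarrow> reval f [instance_code e] 0" for e
  proof -
    have "reval t [e] y \<longleftrightarrow> y = instance_code e" for y
      using t[of "[e]"] reval_deterministic by auto
    then have c: "reval (RComp f [t]) [e] y \<longleftrightarrow> reval f [instance_code e] y" for y
      by (auto simp: reval_RComp_iff list_all2_Cons1)
    have r: "(\<exists>z. reval (RMin (RProj 1)) [y] z) \<longleftrightarrow> y = 0" for y
      by (auto simp: reval_RMin_iff reval_RProj_iff)
    have "reval D [e] z \<longleftrightarrow> (\<exists>y. reval f [instance_code e] y \<and> reval (RMin (RProj 1)) [y] z)" for z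
      unfolding D_def reval_RComp_iff[of "RMin _"] by (auto simp: list_all2_Cons1 c)
    then have "(\<exists>z. reval D [e] z) \<longleftrightarrow>
        (\<exists>y. reval f [instance_code e] y \<and> (\<exists>z. reval (RMin (RProj 1)) [y] z))" by blast
    then show ?thesis unfolding r by blast
  qed
  obtain L :: "(bool \<times> bool) list set" where L: "regular L" "[] \<notin> L"
    "\<And>e z. reval D [e] z \<Longrightarrow> \<exists>w \<in> L. qrun (replicate e False) w []"
    "\<And>e w. w \<in> L \<Longrightarrow> replicate e False @ written w = consumed w \<Longrightarrow> \<exists>z. reval D [e] z"
    using halting_as_queue_language[of D] by blast
  obtain T :: "(nat \<times> (bool \<times> bool) \<times> nat) set" where T: "finite T"
    "\<And>w. path T 1 w 0 \<longleftrightarrow> w \<in> L"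
    "\<And>p a q. (p, a, q) \<in> T \<Longrightarrow> (p = 1 \<or> (even p \<and> p \<noteq> 0)) \<and> (q = 1 \<or> even q)"
    using regular_automaton[OF L(1,2)] by blast
  obtain ts where ts: "set ts = T" using finite_list[OF T(1)] by blast
  define Ts where "Ts = map relabel ts"
  \<comment> \<open>The list \<open>Ts\<close> comes from \<open>D\<close>, and \<open>D\<close>
    from \<open>f\<close> and a function computing \<open>instance_code\<close>, so this choice of
    \<open>e\<close> is not circular.\<close>
  define e where "e = list_encode (map enc_trans Ts)"
  let ?x = "(prot (main_machine e Ts), replicate n 0)"
  have Ts: "set Ts = relabel ` T" by (simp add: Ts_def ts)
  \<comment> \<open>Applied to a transition in \<open>Ts\<close> and to a state in a transition,
    this bounds all states of \<open>T\<close> by \<open>e\<close>.\<close>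
  have mem_le: "x \<in> set xs \<Longrightarrow> x \<le> list_encode xs" for x xs
  proof (induction xs)
    case (Cons y ys)
    then show ?case
      using le_prod_encode_1[of y "list_encode ys"] le_prod_encode_2[of "list_encode ys" y] by auto
  qed simp
  have "p \<le> e \<and> q \<le> e" if "(p, a, q) \<in> T" for p a q
  proof -
    have "enc_trans (relabel (p, a, q)) \<le> e"
      unfolding e_def using that Ts by (intro mem_le) auto
    moreover have "p \<le> enc_trans (relabel (p, a, q))" "q \<le> enc_trans (relabel (p, a, q))"
      unfolding relabel_def trans_of_fst_snd enc_trans_def prod.case
      by (intro mem_le; simp del: list_encode.simps)+
    ultimately show ?thesis by simp
  qed
  then have "instance_ok n es ?x" by (rule instance_ok_main_machine[OF Ts])
  from f[OF this] have
    f': "reval f [instance_code e] (if stable_cs n es (fst ?x) (snd ?x) then 1 else 0)"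
    by (simp add: enc_instance_main_machine[OF e_def])
  have "stable_cs n es (fst ?x) (snd ?x) \<longleftrightarrow> (\<exists>z. reval D [e] z)"
    unfolding fst_conv snd_conv
  proof (rule stable_main_machine_iff[OF _ Ts])
    show "(p = 1 \<or> even p) \<and> (q = 1 \<or> even q)" if "(p, a, q) \<in> T" for p a q
      using T(3)[OF that] by blast
    show "\<exists>w. path T 1 w 0 \<and> qrun (replicate e False) w []" if "\<exists>z. reval D [e] z"
      using that L(3) T(2) by blast
    show "\<exists>z. reval D [e] z" if "path T 1 w 0" "replicate e False @ written w = consumed w" for w
      using that L(4) T(2) by blast
  qed
  \<comment> \<open>If the instance is stable, \<open>f\<close> yields 1, yet \<open>D\<close> halts
    and so \<open>f\<close> yields 0. If it is not, \<open>f\<close> yields 0, so \<open>D\<close>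
    halts and the instance is stable.\<close>
  then show False using f' D[of e] reval_deterministic[OF f'] by (auto split: if_splits)
qed

end

text \<open>Reversal exchanges the first and the last edge and flips the direction of traversal;
  this is how the orientation condition of \<open>oriented_cycle\<close> can always be met.\<close>

lemma undirected_cycle_rev:
  assumes "undirected_cycle es cs vs"
  shows "undirected_cycle es (rev cs) (rev vs)"
proof -
  let ?m = "length cs"
  have c: "cs \<noteq> []" "distinct cs" "\<forall>c \<in> set cs. c < length es" "length vs = Suc ?m"
    "vs ! 0 = vs ! ?m" "distinct (butlast vs)"
    "\<And>k. k < ?m \<Longrightarrow> es ! (cs ! k) = (vs ! k, vs ! Suc k) \<or> es ! (cs ! k) = (vs ! Suc k, vs ! k)"
    using assms by (auto simp: undirected_cycle_def)
  obtain a ys b where vs: "vs = a # ys @ [b]"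
  proof -
    obtain a xs where "vs = a # xs" using c(4) by (cases vs) auto
    moreover have "xs \<noteq> []" using c(1,4) \<open>vs = a # xs\<close> by auto
    ultimately show ?thesis using that by (metis append_butlast_last_id)
  qed
  have "?m = Suc (length ys)" using c(4) vs by simp
  \<comment> \<open>The closing vertex stands at both ends. Dropping either copy leaves the same
    vertices, so distinctness passes to the reversed list.\<close>
  then have "a = b" using c(5) vs by (simp add: nth_append)
  then have "distinct (butlast (rev vs))"
    using c(6) vs by (simp add: butlast_append)
  moreover have "es ! (rev cs ! k) = (rev vs ! k, rev vs ! Suc k) \<or>
      es ! (rev cs ! k) = (rev vs ! Suc k, rev vs ! k)" if "k < ?m" for k
  proof -
    have "rev cs ! k = cs ! (?m - Suc k)" "rev vs ! k = vs ! Suc (?m - Suc k)"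
      "rev vs ! Suc k = vs ! (?m - Suc k)"
      using that c(4) by (auto simp: rev_nth Suc_diff_Suc)
    then show ?thesis using c(7)[of "?m - Suc k"] that by auto
  qed
  moreover have "rev vs ! 0 = rev vs ! length (rev cs)" using c(4,5) by (simp add: rev_nth)
  ultimately show ?thesis using c unfolding undirected_cycle_def by auto
qed

theorem theorem7p2:
  fixes n :: nat and es :: "(nat \<times> nat) list"
  assumes "graph_ok n es"
    and "has_undirected_cycle es"
  shows "\<not> decidable_on enc_instance (instance_ok n es)
            (\<lambda>x. stable_cs n es (fst x) (snd x))"
proof -
  obtain cs vs where cyc: "undirected_cycle es cs vs"
    using assms(2) unfolding has_undirected_cycle_def by blast
  let ?m = "length cs"
  have m: "0 < ?m" "length vs = Suc ?m" using cyc by (auto simp: undirected_cycle_def)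
  have "\<exists>cs vs. oriented_cycle n es cs vs"
  proof (cases "es ! (cs ! (?m - 1)) = (vs ! (?m - 1), vs ! ?m)")
    case True
    then have "oriented_cycle n es cs vs" using assms(1) cyc by unfold_locales auto
    then show ?thesis by blast
  next
    case False
    have "\<forall>k<?m. es ! (cs ! k) = (vs ! k, vs ! Suc k) \<or> es ! (cs ! k) = (vs ! Suc k, vs ! k)"
      using cyc by (simp add: undirected_cycle_def)
    then have "es ! (cs ! (?m - 1)) = (vs ! (?m - 1), vs ! Suc (?m - 1)) \<or>
        es ! (cs ! (?m - 1)) = (vs ! Suc (?m - 1), vs ! (?m - 1))"
      by (rule allE[of _ "?m - 1"]) (use m(1) in simp)
    then have "es ! (rev cs ! 0) = (rev vs ! 0, rev vs ! 1)"
      using False m by (auto simp: rev_nth)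
    then have "oriented_cycle n es (rev cs) (rev vs)"
      using assms(1) undirected_cycle_rev[OF cyc] by unfold_locales auto
    then show ?thesis by blast
  qed
  then show ?thesis using oriented_cycle.stable_undecidable by blast
qed

end
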